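(* For $\alpha$ small enough and $\varepsilon=\pm$, the function $\chi^\varepsilon$ and its derivative with respect to $s$ have the following expansions: $$\chi^\varepsilon(\alpha,r,s)=f_0^\varepsilon(s,r)+f_1^\varepsilon(s,r)\alpha+f_2^\varepsilon(s,r)\alpha^2+\mathcal O(\alpha^3),$$ $$\frac{\partial}{\partial s}\chi^\varepsilon(\alpha,r,s)=\frac{\partial}{\partial s}f_0^\varepsilon(s,r)+\frac{\partial}{\partial s}f_1^\varepsilon(s,r)\alpha+\frac{\partial}{\partial s}f_2^\varepsilon(s,r)\alpha^2+\mathcal O(\alpha^3),$$ where $$f_0^+(s,r)=\begin{pmatrix}0\\0\\-1\end{pmatrix},\quad f_1^+(s,r)=\begin{pmatrix}-2r\cos s\\2r\sin s\\0\end{pmatrix},\quad f_2^+(s,r)=\begin{pmatrix}\frac{\pi}{2}(4r+\cos s)\sin^2 s\\ \frac{\pi}{4}(3+8r\cos s+\cos 2s)\sin s\\2r^2\end{pmatrix},$$ $f_l^-=\mathrm{Diag}(-1,-1,1)f_l^+$ for $l=0,1,2$, and $|\mathcal O(\alpha^3)|\le C|\alpha^3|$ with the constant $C$ independent of $s\in\mathbb R$ and $r\in[0,1)$.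
   Context: Let $$F=\begin{pmatrix}0&-\cos\alpha&0\\ \cos\alpha&0&0\\0&0&0\end{pmatrix},\quad G=\begin{pmatrix}0&0&0\\0&0&-\sin\alpha\\0&\sin\alpha&0\end{pmatrix},\quad X_\pm=F\pm G,\quad N=(0,0,1)^T,$$ $v(s)=\pi+2\arctan\frac{\sin s}{\cos s+\cot^2\alpha}$, and $$Z_{\pm}(t)=\begin{pmatrix}0&-C(t)&\mp B(t)\\ C(t)&0&0\\ \pm B(t)&0&0\end{pmatrix},\quad B(t)=\frac{\sin\alpha\,\sin(t/2)}{\sqrt{\sin^2(t/2)\sin^2\alpha+\cos^2(t/2)}},\quad C(t)=\frac{-\cos(t/2)}{\sqrt{\sin^2(t/2)\sin^2\alpha+\cos^2(t/2)}},$$ $$\Theta(t)=2\arccos\big(\sin^2(t/2)\cos2\alpha-\cos^2(t/2)\big).$$ (So $e^{tX_+}e^{tX_-}=e^{\Theta(t)Z_-(t)}$ and $e^{tX_-}e^{tX_+}=e^{\Theta(t)Z_+(t)}$.) Treating $\alpha$ and $r$ as independent variables, put $$\psi(\alpha,r,s)=\Big(\frac{\pi}{2\alpha}-r\Big)(\pi-v(s))+v(s)-s,\qquad \theta(\alpha,r,s)=\Big(\frac{\pi}{4\alpha}-\frac{1+r}{2}\Big)\Theta(v(s)),$$ $$\chi^\varepsilon(\alpha,r,s)=e^{\psi(\alpha,r,s)X_{-\varepsilon}}\,e^{\theta(\alpha,r,s)Z_{-\varepsilon}(v(s))}\,e^{sX_\varepsilon}N .$$ *)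

theory Defs
  imports "HOL-Analysis.Analysis"
begin

text \<open>
  The type \<open>real^3^3\<close> is not an instance of the Banach algebra classes on which \<^const>\<open>exp\<close> is
  defined, so the matrix exponential is given by its power series.
\<close>

definition mat_power :: "real^'n^'n \<Rightarrow> nat \<Rightarrow> real^'n^'n" where
  "mat_power A k = ((\<lambda>B. A ** B) ^^ k) (mat 1)"

definition mat_exp :: "real^'n^'n \<Rightarrow> real^'n^'n" where
  "mat_exp A = (\<Sum>k. (1 / fact k) *\<^sub>R mat_power A k)"

definition F_mat :: "real \<Rightarrow> real^3^3" where
  "F_mat \<alpha> = vector [vector [0, - cos \<alpha>, 0],
                     vector [cos \<alpha>, 0, 0],
                     vector [0, 0, 0]]"

definition G_mat :: "real \<Rightarrow> real^3^3" where
  "G_mat \<alpha> = vector [vector [0, 0, 0],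
                     vector [0, 0, - sin \<alpha>],
                     vector [0, sin \<alpha>, 0]]"

text \<open>
  In all definitions below, the superscript or subscript \<open>\<plusminus>\<close> is a real parameter \<open>\<epsilon>\<close> that is only
  meant to take the values \<open>1\<close> and \<open>-1\<close>.
\<close>

definition X_mat :: "real \<Rightarrow> real \<Rightarrow> real^3^3" where
  "X_mat \<epsilon> \<alpha> = F_mat \<alpha> + \<epsilon> *\<^sub>R G_mat \<alpha>"

definition north_pole :: "real^3" where
  "north_pole = vector [0, 0, 1]"

definition v_fun :: "real \<Rightarrow> real \<Rightarrow> real" where
  "v_fun \<alpha> s = pi + 2 * arctan (sin s / (cos s + (cot \<alpha>)\<^sup>2))"

definition B_coeff :: "real \<Rightarrow> real \<Rightarrow> real" where
  "B_coeff \<alpha> t = sin \<alpha> * sin (t/2) / sqrt ((sin (t/2))\<^sup>2 * (sin \<alpha>)\<^sup>2 + (cos (t/2))\<^sup>2)"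

definition C_coeff :: "real \<Rightarrow> real \<Rightarrow> real" where
  "C_coeff \<alpha> t = - cos (t/2) / sqrt ((sin (t/2))\<^sup>2 * (sin \<alpha>)\<^sup>2 + (cos (t/2))\<^sup>2)"

definition Z_mat :: "real \<Rightarrow> real \<Rightarrow> real \<Rightarrow> real^3^3" where
  "Z_mat \<epsilon> \<alpha> t = vector [vector [0, - C_coeff \<alpha> t, - \<epsilon> * B_coeff \<alpha> t],
                         vector [C_coeff \<alpha> t, 0, 0],
                         vector [\<epsilon> * B_coeff \<alpha> t, 0, 0]]"

definition Theta_angle :: "real \<Rightarrow> real \<Rightarrow> real" where
  "Theta_angle \<alpha> t = 2 * arccos ((sin (t/2))\<^sup>2 * cos (2 * \<alpha>) - (cos (t/2))\<^sup>2)"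

definition psi_time :: "real \<Rightarrow> real \<Rightarrow> real \<Rightarrow> real" where
  "psi_time \<alpha> r s = (pi / (2 * \<alpha>) - r) * (pi - v_fun \<alpha> s) + v_fun \<alpha> s - s"

definition theta_time :: "real \<Rightarrow> real \<Rightarrow> real \<Rightarrow> real" where
  "theta_time \<alpha> r s = (pi / (4 * \<alpha>) - (1 + r) / 2) * Theta_angle \<alpha> (v_fun \<alpha> s)"

definition chi :: "real \<Rightarrow> real \<Rightarrow> real \<Rightarrow> real \<Rightarrow> real^3" where
  "chi \<epsilon> \<alpha> r s =
     (mat_exp (psi_time \<alpha> r s *\<^sub>R X_mat (- \<epsilon>) \<alpha>)
      ** mat_exp (theta_time \<alpha> r s *\<^sub>R Z_mat (- \<epsilon>) \<alpha> (v_fun \<alpha> s))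
      ** mat_exp (s *\<^sub>R X_mat \<epsilon> \<alpha>)) *v north_pole"

definition f0_plus :: "real \<Rightarrow> real \<Rightarrow> real^3" where
  "f0_plus s r = vector [0, 0, -1]"

definition f1_plus :: "real \<Rightarrow> real \<Rightarrow> real^3" where
  "f1_plus s r = vector [- 2 * r * cos s, 2 * r * sin s, 0]"

definition f2_plus :: "real \<Rightarrow> real \<Rightarrow> real^3" where
  "f2_plus s r = vector [pi / 2 * (4 * r + cos s) * (sin s)\<^sup>2,
                         pi / 4 * (3 + 8 * r * cos s + cos (2 * s)) * sin s,
                         2 * r\<^sup>2]"

definition sign_diag :: "real \<Rightarrow> real^3^3" where
  "sign_diag \<epsilon> = (if \<epsilon> = 1 then mat 1
                  else vector [vector [-1, 0, 0], vector [0, -1, 0], vector [0, 0, 1]])"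

definition f0 :: "real \<Rightarrow> real \<Rightarrow> real \<Rightarrow> real^3" where
  "f0 \<epsilon> s r = sign_diag \<epsilon> *v f0_plus s r"

definition f1 :: "real \<Rightarrow> real \<Rightarrow> real \<Rightarrow> real^3" where
  "f1 \<epsilon> s r = sign_diag \<epsilon> *v f1_plus s r"

definition f2 :: "real \<Rightarrow> real \<Rightarrow> real \<Rightarrow> real^3" where
  "f2 \<epsilon> s r = sign_diag \<epsilon> *v f2_plus s r"

end

theory Submission
  imports Defs "HOL-Real_Asymp.Real_Asymp"
begin

text \<open>
  All generators are skew-symmetric with unit rotation axis, so Rodrigues' formula turns \<open>\<chi>\<close> into a
  polynomial in \<open>sin \<alpha>\<close>, \<open>cos \<alpha>\<close>, \<open>B\<close>, \<open>C\<close> and the sines and cosines of \<open>s\<close>, \<open>\<theta>\<close> and \<open>\<psi>\<close>; the sign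
  \<open>\<epsilon>\<close> only multiplies the first two components. Writing \<open>v = \<pi> + 2w\<close> one has
  \<open>w = \<alpha>\<^sup>2 sin s + O(\<alpha>\<^sup>4)\<close>, \<open>\<theta> = \<pi> + O(\<alpha>)\<close> and \<open>\<psi> = \<pi> - s + O(\<alpha>)\<close>, so every ingredient has a
  second order expansion in \<open>\<alpha>\<close> whose error and \<open>s\<close>-derivative of the error are \<open>O(\<alpha>\<^sup>3)\<close> uniformly in
  \<open>r\<close> and \<open>s\<close>. Such expansions can be added, multiplied and composed with smooth functions, which
  reduces the claim to arithmetic modulo \<open>\<alpha>\<^sup>3\<close>.
\<close>

subsection \<open>Uniform second order expansions\<close>

text \<open>One constant serves both the function and its \<open>s\<close>-derivative, so a single
  estimate of the error yields both expansions of the theorem. Only \<open>s\<close> is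
  differentiated; \<open>r\<close> is a parameter.\<close>

definition C1_bound :: "real \<Rightarrow> (real \<Rightarrow> real \<Rightarrow> real) \<Rightarrow> bool" where
  "C1_bound B g \<longleftrightarrow> (\<forall>r s. 0 \<le> r \<and> r < 1 \<longrightarrow>
     (\<exists>D. (g r has_real_derivative D) (at s) \<and> \<bar>g r s\<bar> \<le> B \<and> \<bar>D\<bar> \<le> B))"

lemma C1_boundI:
  assumes "\<And>r s. 0 \<le> r \<Longrightarrow> r < 1 \<Longrightarrow> (g r has_real_derivative D r s) (at s)"
    "\<And>r s. 0 \<le> r \<Longrightarrow> r < 1 \<Longrightarrow> \<bar>g r s\<bar> \<le> B" "\<And>r s. 0 \<le> r \<Longrightarrow> r < 1 \<Longrightarrow> \<bar>D r s\<bar> \<le> B"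
  shows "C1_bound B g"
  unfolding C1_bound_def using assms by blast

lemma C1_boundE:
  assumes "C1_bound B g"
  obtains D where "\<And>r s. 0 \<le> r \<Longrightarrow> r < 1 \<Longrightarrow> (g r has_real_derivative D r s) (at s)"
    "\<And>r s. 0 \<le> r \<Longrightarrow> r < 1 \<Longrightarrow> \<bar>g r s\<bar> \<le> B" "\<And>r s. 0 \<le> r \<Longrightarrow> r < 1 \<Longrightarrow> \<bar>D r s\<bar> \<le> B"
proof -
  have "\<forall>r s. \<exists>D. 0 \<le> r \<and> r < 1 \<longrightarrow> (g r has_real_derivative D) (at s) \<and> \<bar>g r s\<bar> \<le> B \<and> \<bar>D\<bar> \<le> B"
    using assms unfolding C1_bound_def by blast
  then obtain D where "\<forall>r s. 0 \<le> r \<and> r < 1 \<longrightarrow>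
      (g r has_real_derivative D r s) (at s) \<and> \<bar>g r s\<bar> \<le> B \<and> \<bar>D r s\<bar> \<le> B"
    by metis
  then show ?thesis by (intro that[of D]) auto
qed

lemma C1_bound_add:
  assumes "C1_bound B f" "C1_bound B' g"
  shows "C1_bound (B + B') (\<lambda>r s. f r s + g r s)"
proof -
  from assms obtain D D' where D: "\<And>r s. 0 \<le> r \<Longrightarrow> r < 1 \<Longrightarrow> (f r has_real_derivative D r s) (at s)"
    "\<And>r s. 0 \<le> r \<Longrightarrow> r < 1 \<Longrightarrow> \<bar>f r s\<bar> \<le> B" "\<And>r s. 0 \<le> r \<Longrightarrow> r < 1 \<Longrightarrow> \<bar>D r s\<bar> \<le> B"
    "\<And>r s. 0 \<le> r \<Longrightarrow> r < 1 \<Longrightarrow> (g r has_real_derivative D' r s) (at s)"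
    "\<And>r s. 0 \<le> r \<Longrightarrow> r < 1 \<Longrightarrow> \<bar>g r s\<bar> \<le> B'" "\<And>r s. 0 \<le> r \<Longrightarrow> r < 1 \<Longrightarrow> \<bar>D' r s\<bar> \<le> B'"
    by (elim C1_boundE) blast
  show ?thesis
    by (rule C1_boundI[where D = "\<lambda>r s. D r s + D' r s"])
       (auto intro: DERIV_add D order_trans[OF abs_triangle_ineq] add_mono)
qed

text \<open>The factor 2 comes from the product rule, each of whose two terms is at most
  \<open>B * B'\<close>.\<close>

lemma C1_bound_mult:
  assumes "C1_bound B f" "C1_bound B' g"
  shows "C1_bound (2 * B * B') (\<lambda>r s. f r s * g r s)"
proof -
  from assms obtain D D' where D: "\<And>r s. 0 \<le> r \<Longrightarrow> r < 1 \<Longrightarrow> (f r has_real_derivative D r s) (at s)"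
    "\<And>r s. 0 \<le> r \<Longrightarrow> r < 1 \<Longrightarrow> \<bar>f r s\<bar> \<le> B" "\<And>r s. 0 \<le> r \<Longrightarrow> r < 1 \<Longrightarrow> \<bar>D r s\<bar> \<le> B"
    "\<And>r s. 0 \<le> r \<Longrightarrow> r < 1 \<Longrightarrow> (g r has_real_derivative D' r s) (at s)"
    "\<And>r s. 0 \<le> r \<Longrightarrow> r < 1 \<Longrightarrow> \<bar>g r s\<bar> \<le> B'" "\<And>r s. 0 \<le> r \<Longrightarrow> r < 1 \<Longrightarrow> \<bar>D' r s\<bar> \<le> B'"
    by (elim C1_boundE) blast
  have prod: "\<bar>x * y\<bar> \<le> B * B'" if "\<bar>x\<bar> \<le> B" "\<bar>y\<bar> \<le> B'" for x y
    using mult_mono'[OF that] by (simp add: abs_mult)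
  show ?thesis
  proof (rule C1_boundI[where D = "\<lambda>r s. D r s * g r s + D' r s * f r s"])
    fix r s :: real assume r: "0 \<le> r" "r < 1"
    show "((\<lambda>s. f r s * g r s) has_real_derivative D r s * g r s + D' r s * f r s) (at s)"
      by (intro DERIV_mult D r)
    have "\<bar>f r s * g r s\<bar> \<le> B * B'" "\<bar>D r s * g r s\<bar> \<le> B * B'" "\<bar>f r s * D' r s\<bar> \<le> B * B'"
      by (intro prod D r)+
    then show "\<bar>f r s * g r s\<bar> \<le> 2 * B * B'" "\<bar>D r s * g r s + D' r s * f r s\<bar> \<le> 2 * B * B'"
      by (auto simp: mult.commute[of "D' r s"])
  qed
qed

lemma C1_bound_mono: "C1_bound B f \<Longrightarrow> B \<le> B' \<Longrightarrow> C1_bound B' f"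
  unfolding C1_bound_def by (meson order_trans)

text \<open>Vanishing of order \<open>n\<close> of the derivative becomes order \<open>n + 1\<close>
  for the function by the mean value inequality on a ball around 0. For the derivative of the
  composition, the chain rule factor \<open>D r s\<close>, bounded by \<open>B\<close>, supplies the
  missing power.\<close>

lemma C1_bound_compose:
  assumes f: "C1_bound B f" and B: "B < d" and "0 \<le> M"
    and der: "\<And>x. \<bar>x\<bar> < d \<Longrightarrow> (\<phi> has_real_derivative \<phi>' x) (at x)"
    and bd: "\<And>x. \<bar>x\<bar> < d \<Longrightarrow> \<bar>\<phi>' x\<bar> \<le> M * \<bar>x\<bar> ^ n"
  shows "C1_bound (M * B ^ Suc n) (\<lambda>r s. \<phi> (f r s) - \<phi> 0)"
proof -
  have \<phi>: "\<bar>\<phi> x - \<phi> 0\<bar> \<le> M * \<bar>x\<bar> ^ Suc n" if x: "\<bar>x\<bar> < d" for x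
  proof -
    have "norm (\<phi> x - \<phi> 0) \<le> (M * \<bar>x\<bar> ^ n) * norm (x - 0)"
    proof (rule field_differentiable_bound[of "cball 0 \<bar>x\<bar>" \<phi> \<phi>'])
      fix z :: real assume z: "z \<in> cball 0 \<bar>x\<bar>"
      then have "\<bar>z\<bar> < d" "\<bar>z\<bar> \<le> \<bar>x\<bar>" using x by auto
      then show "(\<phi> has_real_derivative \<phi>' z) (at z within cball 0 \<bar>x\<bar>)"
        using der has_field_derivative_at_within by blast
      have "\<bar>\<phi>' z\<bar> \<le> M * \<bar>z\<bar> ^ n" using bd \<open>\<bar>z\<bar> < d\<close> by blast
      also have "\<dots> \<le> M * \<bar>x\<bar> ^ n" using \<open>\<bar>z\<bar> \<le> \<bar>x\<bar>\<close> \<open>0 \<le> M\<close>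
        by (intro mult_left_mono power_mono) auto
      finally show "norm (\<phi>' z) \<le> M * \<bar>x\<bar> ^ n" by simp
    qed auto
    then show ?thesis by (simp add: mult_ac)
  qed
  from f obtain D where D: "\<And>r s. 0 \<le> r \<Longrightarrow> r < 1 \<Longrightarrow> (f r has_real_derivative D r s) (at s)"
    "\<And>r s. 0 \<le> r \<Longrightarrow> r < 1 \<Longrightarrow> \<bar>f r s\<bar> \<le> B" "\<And>r s. 0 \<le> r \<Longrightarrow> r < 1 \<Longrightarrow> \<bar>D r s\<bar> \<le> B"
    by (elim C1_boundE) blast
  show ?thesis
  proof (rule C1_boundI[where D = "\<lambda>r s. \<phi>' (f r s) * D r s"])
    fix r s :: real assume r: "0 \<le> r" "r < 1"
    let ?x = "f r s"
    have lt: "\<bar>?x\<bar> < d" using D(2)[OF r, of s] B by linarith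
    have pw: "\<bar>?x\<bar> ^ j \<le> B ^ j" for j
      using D(2)[OF r] by (intro power_mono) auto
    have "((\<lambda>s. \<phi> (f r s)) has_real_derivative \<phi>' ?x * D r s) (at s)"
      using DERIV_chain2[OF der[OF lt] D(1)[OF r]] .
    from DERIV_diff[OF this DERIV_const[of "\<phi> 0"]]
    show "((\<lambda>s. \<phi> (f r s) - \<phi> 0) has_real_derivative \<phi>' ?x * D r s) (at s)" by simp
    have "\<bar>\<phi> ?x - \<phi> 0\<bar> \<le> M * \<bar>?x\<bar> ^ Suc n" by (rule \<phi>[OF lt])
    also have "\<dots> \<le> M * B ^ Suc n" using \<open>0 \<le> M\<close> pw by (rule mult_left_mono[rotated])
    finally show "\<bar>\<phi> ?x - \<phi> 0\<bar> \<le> M * B ^ Suc n" .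
    have "\<bar>\<phi>' ?x\<bar> \<le> M * B ^ n"
      using bd[OF lt] mult_left_mono[OF pw[of n] \<open>0 \<le> M\<close>] by linarith
    then have "\<bar>\<phi>' ?x\<bar> * \<bar>D r s\<bar> \<le> (M * B ^ n) * B"
      using D(3)[OF r, of s] by (intro mult_mono') auto
    then show "\<bar>\<phi>' ?x * D r s\<bar> \<le> M * B ^ Suc n" by (simp add: abs_mult mult_ac)
  qed
qed

text \<open>Uniformity lies in the order of choice: \<open>C\<close> comes before \<alpha>, and
  \<open>r\<close>, \<open>s\<close> are quantified inside \<open>C1_bound\<close>.\<close>

definition unif_O :: "nat \<Rightarrow> (real \<Rightarrow> real \<Rightarrow> real \<Rightarrow> real) \<Rightarrow> bool" where
  "unif_O k f \<longleftrightarrow> (\<exists>C. \<forall>\<^sub>F \<alpha> in at_right 0. C1_bound (C * \<alpha> ^ k) (f \<alpha>))"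

lemma unif_OI: "\<forall>\<^sub>F \<alpha> in at_right 0. C1_bound (C * \<alpha> ^ k) (f \<alpha>) \<Longrightarrow> unif_O k f"
  by (auto simp: unif_O_def)

lemma unif_OE:
  assumes "unif_O k f"
  obtains C where "0 \<le> C" "\<forall>\<^sub>F \<alpha> in at_right 0. C1_bound (C * \<alpha> ^ k) (f \<alpha>)"
proof -
  from assms obtain C where C: "\<forall>\<^sub>F \<alpha> in at_right 0. C1_bound (C * \<alpha> ^ k) (f \<alpha>)"
    by (auto simp: unif_O_def)
  have "\<forall>\<^sub>F \<alpha> in at_right 0. C1_bound (\<bar>C\<bar> * \<alpha> ^ k) (f \<alpha>)"
    using C eventually_at_right_less[of "0::real"]
    by eventually_elim (auto elim!: C1_bound_mono intro!: mult_right_mono)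
  then show ?thesis by (rule that[rotated]) auto
qed

lemma unif_O_cong:
  assumes "\<forall>\<^sub>F \<alpha> in at_right 0. \<forall>r s. f \<alpha> r s = g \<alpha> r s" and "unif_O k f"
  shows "unif_O k g"
proof -
  from assms(2) obtain C where "\<forall>\<^sub>F \<alpha> in at_right 0. C1_bound (C * \<alpha> ^ k) (f \<alpha>)"
    by (elim unif_OE)
  with assms(1) have "\<forall>\<^sub>F \<alpha> in at_right 0. C1_bound (C * \<alpha> ^ k) (g \<alpha>)"
  proof eventually_elim
    case (elim \<alpha>)
    then have "f \<alpha> = g \<alpha>" by (auto simp: fun_eq_iff)
    with elim show ?case by simp
  qed
  then show ?thesis by (rule unif_OI)
qed

lemma unif_O_eq: "unif_O k f \<Longrightarrow> (\<And>\<alpha> r s. f \<alpha> r s = g \<alpha> r s) \<Longrightarrow> unif_O k g"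
  by (rule unif_O_cong[of f g]) auto

text \<open>The bridge from one-variable asymptotics in \<alpha>, which \<open>real_asymp\<close>
  settles, to uniform bounds: the \<open>s\<close>-derivative is zero.\<close>

lemma unif_O_const_in_s:
  assumes "h \<in> O[at_right 0](\<lambda>\<alpha>. \<alpha> ^ k)"
  shows "unif_O k (\<lambda>\<alpha> r s. h \<alpha>)"
proof -
  from assms obtain C where C: "C > 0" "\<forall>\<^sub>F \<alpha> in at_right 0. norm (h \<alpha>) \<le> C * norm (\<alpha> ^ k)"
    by (auto elim!: landau_o.bigE)
  have "\<forall>\<^sub>F \<alpha> in at_right 0. C1_bound (C * \<alpha> ^ k) (\<lambda>r s. h \<alpha>)"
    using C(2) eventually_at_right_less[of "0::real"]
    by eventually_elim (rule C1_boundI[where D = "\<lambda>_ _. 0"], use C(1) in auto)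
  then show ?thesis by (rule unif_OI)
qed

lemma unif_O_add:
  assumes "unif_O k f" "unif_O k g"
  shows "unif_O k (\<lambda>\<alpha> r s. f \<alpha> r s + g \<alpha> r s)"
proof -
  from assms obtain C C' where "\<forall>\<^sub>F \<alpha> in at_right 0. C1_bound (C * \<alpha> ^ k) (f \<alpha>)"
    "\<forall>\<^sub>F \<alpha> in at_right 0. C1_bound (C' * \<alpha> ^ k) (g \<alpha>)"
    by (elim unif_OE)
  then have "\<forall>\<^sub>F \<alpha> in at_right 0. C1_bound ((C + C') * \<alpha> ^ k) (\<lambda>r s. f \<alpha> r s + g \<alpha> r s)"
    by eventually_elim (simp add: distrib_right C1_bound_add)
  then show ?thesis by (rule unif_OI)
qed

lemma unif_O_mult:
  assumes "unif_O k f" "unif_O l g"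
  shows "unif_O (k + l) (\<lambda>\<alpha> r s. f \<alpha> r s * g \<alpha> r s)"
proof -
  from assms obtain C C' where "\<forall>\<^sub>F \<alpha> in at_right 0. C1_bound (C * \<alpha> ^ k) (f \<alpha>)"
    "\<forall>\<^sub>F \<alpha> in at_right 0. C1_bound (C' * \<alpha> ^ l) (g \<alpha>)"
    by (elim unif_OE)
  then have "\<forall>\<^sub>F \<alpha> in at_right 0. C1_bound ((2 * C * C') * \<alpha> ^ (k + l)) (\<lambda>r s. f \<alpha> r s * g \<alpha> r s)"
  proof eventually_elim
    case (elim \<alpha>)
    from C1_bound_mult[OF elim] show ?case by (simp add: power_add mult_ac)
  qed
  then show ?thesis by (rule unif_OI)
qed

lemma unif_O_mono:
  assumes "unif_O l f" "k \<le> l"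
  shows "unif_O k f"
proof -
  from assms(1) obtain C where C: "0 \<le> C" "\<forall>\<^sub>F \<alpha> in at_right 0. C1_bound (C * \<alpha> ^ l) (f \<alpha>)"
    by (elim unif_OE)
  have "\<forall>\<^sub>F \<alpha> in at_right 0. C1_bound (C * \<alpha> ^ k) (f \<alpha>)"
    using C(2) eventually_at_right_real[of 0 "1::real", OF zero_less_one]
    by eventually_elim
       (use C(1) assms(2) in \<open>auto elim!: C1_bound_mono intro!: mult_left_mono power_decreasing\<close>)
  then show ?thesis by (rule unif_OI)
qed

text \<open>The rotation times contain \<pi> / \<alpha>, so division by \<alpha> is unavoidable. It
  costs one order, and 1 / \<alpha> enters as a factor constant in \<open>s\<close>.\<close>

lemma unif_O_divide:
  assumes "unif_O (Suc k) f"
  shows "unif_O k (\<lambda>\<alpha> r s. f \<alpha> r s / \<alpha>)"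
proof -
  from assms obtain C where "\<forall>\<^sub>F \<alpha> in at_right 0. C1_bound (C * \<alpha> ^ Suc k) (f \<alpha>)"
    by (elim unif_OE)
  then have "\<forall>\<^sub>F \<alpha> in at_right 0. C1_bound (2 * C * \<alpha> ^ k) (\<lambda>r s. f \<alpha> r s / \<alpha>)"
    using eventually_at_right_less[of "0::real"]
  proof eventually_elim
    case (elim \<alpha>)
    have "C1_bound (1 / \<alpha>) (\<lambda>r s. 1 / \<alpha>)"
      using elim(2) by (intro C1_boundI[where D = "\<lambda>_ _. 0"]) auto
    from C1_bound_mult[OF elim(1) this] show ?case using elim(2) by (simp add: mult_ac)
  qed
  then show ?thesis by (rule unif_OI)
qed

text \<open>Since \<open>k\<close> is positive, the inner function eventually stays inside the
  neighbourhood of 0 where the local information on \<phi> is valid. The bound at the filter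
  \<open>at 0\<close> says nothing about the point 0 itself, hence the last hypothesis.\<close>

lemma unif_O_compose:
  assumes f: "unif_O k f" and k: "0 < k"
    and der: "\<forall>\<^sub>F x in nhds 0. (\<phi> has_real_derivative \<phi>' x) (at x)"
    and bigo: "\<phi>' \<in> O[at 0](\<lambda>x. x ^ n)" and "n = 0 \<or> \<phi>' 0 = 0"
  shows "unif_O (k * Suc n) (\<lambda>\<alpha> r s. \<phi> (f \<alpha> r s) - \<phi> 0)"
proof -
  from bigo obtain M where M: "M > 0" "\<forall>\<^sub>F x in at 0. norm (\<phi>' x) \<le> M * norm (x ^ n)"
    by (auto elim!: landau_o.bigE)
  \<comment> \<open>The extra summand covers the point 0 in the case \<open>n = 0\<close>, where the
    derivative need not vanish.\<close>
  define M' where "M' = M + \<bar>\<phi>' 0\<bar>"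
  have "M' > 0" using M(1) by (simp add: M'_def)
  have "\<forall>\<^sub>F x in nhds 0. \<bar>\<phi>' x\<bar> \<le> M' * \<bar>x\<bar> ^ n"
    using M(2) unfolding eventually_at_filter
  proof eventually_elim
    case (elim x)
    show ?case
    proof (cases "x = 0")
      case True
      then show ?thesis using assms(5) M(1) by (cases n) (auto simp: M'_def)
    next
      case False
      with elim have "\<bar>\<phi>' x\<bar> \<le> M * \<bar>x\<bar> ^ n" by (simp add: power_abs)
      also have "\<dots> \<le> M' * \<bar>x\<bar> ^ n" by (intro mult_right_mono) (auto simp: M'_def)
      finally show ?thesis .
    qed
  qed
  with der have "\<forall>\<^sub>F x in nhds 0. (\<phi> has_real_derivative \<phi>' x) (at x) \<and> \<bar>\<phi>' x\<bar> \<le> M' * \<bar>x\<bar> ^ n"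
    by eventually_elim simp
  then obtain d where d: "d > 0" and dd:
    "\<And>x. \<bar>x\<bar> < d \<Longrightarrow> (\<phi> has_real_derivative \<phi>' x) (at x) \<and> \<bar>\<phi>' x\<bar> \<le> M' * \<bar>x\<bar> ^ n"
    unfolding eventually_nhds_metric by (auto simp: dist_real_def)
  from f obtain C where C: "0 \<le> C" "\<forall>\<^sub>F \<alpha> in at_right 0. C1_bound (C * \<alpha> ^ k) (f \<alpha>)"
    by (elim unif_OE)
  have "((\<lambda>\<alpha>. C * \<alpha> ^ k) \<longlongrightarrow> C * 0 ^ k) (at_right 0)"
    by (intro tendsto_intros)
  then have "\<forall>\<^sub>F \<alpha> in at_right 0. C * \<alpha> ^ k < d"
    by (rule order_tendstoD(2)) (use k d in \<open>simp add: zero_power\<close>)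
  with C(2) have "\<forall>\<^sub>F \<alpha> in at_right 0. C1_bound ((M' * C ^ Suc n) * \<alpha> ^ (k * Suc n))
     (\<lambda>r s. \<phi> (f \<alpha> r s) - \<phi> 0)"
  proof eventually_elim
    case (elim \<alpha>)
    have "C1_bound (M' * (C * \<alpha> ^ k) ^ Suc n) (\<lambda>r s. \<phi> (f \<alpha> r s) - \<phi> 0)"
      using elim \<open>M' > 0\<close> dd by (intro C1_bound_compose[of _ _ d]) auto
    then show ?case by (simp only: power_mult_distrib power_mult mult.assoc)
  qed
  then show ?thesis by (rule unif_OI)
qed

text \<open>An expansion modulo \<open>\<alpha> ^ 3\<close>. For functions free of \<alpha>,
  \<open>unif_O 0\<close> means boundedness together with the \<open>s\<close>-derivative; demanding
  it of the coefficients keeps a coefficient times an error within the error class.\<close>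

definition jet :: "(real \<Rightarrow> real \<Rightarrow> real \<Rightarrow> real) \<Rightarrow> (real \<Rightarrow> real \<Rightarrow> real) \<Rightarrow> (real \<Rightarrow> real \<Rightarrow> real) \<Rightarrow>
    (real \<Rightarrow> real \<Rightarrow> real) \<Rightarrow> bool" where
  "jet f a0 a1 a2 \<longleftrightarrow> unif_O 0 (\<lambda>\<alpha>. a0) \<and> unif_O 0 (\<lambda>\<alpha>. a1) \<and> unif_O 0 (\<lambda>\<alpha>. a2) \<and>
     unif_O 3 (\<lambda>\<alpha> r s. f \<alpha> r s - (a0 r s + \<alpha> * a1 r s + \<alpha>\<^sup>2 * a2 r s))"

text \<open>Applied first, it leaves the coefficients of its premise schematic. The arithmetic rules
  for jets then compute them, and what remains are identities between coefficient functions.\<close>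

lemma jet_cong:
  assumes "jet f a0 a1 a2" "\<And>r s. a0 r s = b0 r s" "\<And>r s. a1 r s = b1 r s" "\<And>r s. a2 r s = b2 r s"
  shows "jet f b0 b1 b2"
proof -
  have "a0 = b0" "a1 = b1" "a2 = b2" using assms by (auto simp: fun_eq_iff)
  with assms(1) show ?thesis by simp
qed

lemma jet_eventually_cong:
  assumes "jet f a0 a1 a2" "\<forall>\<^sub>F \<alpha> in at_right 0. \<forall>r s. f \<alpha> r s = g \<alpha> r s"
  shows "jet g a0 a1 a2"
proof -
  have "\<forall>\<^sub>F \<alpha> in at_right 0. \<forall>r s. f \<alpha> r s - (a0 r s + \<alpha> * a1 r s + \<alpha>\<^sup>2 * a2 r s) =
      g \<alpha> r s - (a0 r s + \<alpha> * a1 r s + \<alpha>\<^sup>2 * a2 r s)"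
    using assms(2) by eventually_elim simp
  from unif_O_cong[OF this] show ?thesis using assms(1) unfolding jet_def by blast
qed

lemma unif_O_power [simp]: "unif_O k (\<lambda>\<alpha> r s. \<alpha> ^ k)"
  by (intro unif_O_const_in_s) auto

lemma unif_O_const [simp]: "unif_O 0 (\<lambda>\<alpha> r s. c)"
  by (intro unif_O_const_in_s) auto

lemma unif_O_zero [simp]: "unif_O k (\<lambda>\<alpha> r s. 0)"
  using unif_O_const_in_s[of "\<lambda>_. 0"] by simp

lemma jet_O3: "unif_O 3 f \<Longrightarrow> jet f (\<lambda>_ _. 0) (\<lambda>_ _. 0) (\<lambda>_ _. 0)"
  by (simp add: jet_def)

lemma jet_unif_O:
  assumes "jet f a0 a1 a2"
  shows "unif_O 0 f"
proof -
  have a: "unif_O 0 (\<lambda>\<alpha>. a0)" "unif_O 0 (\<lambda>\<alpha>. a1)" "unif_O 0 (\<lambda>\<alpha>. a2)"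
    and f: "unif_O 3 (\<lambda>\<alpha> r s. f \<alpha> r s - (a0 r s + \<alpha> * a1 r s + \<alpha>\<^sup>2 * a2 r s))"
    using assms unfolding jet_def by auto
  have p: "unif_O 0 (\<lambda>\<alpha> r s. \<alpha> ^ k * a r s)" if "unif_O 0 (\<lambda>\<alpha>. a)" for k a
    by (rule unif_O_mono[OF unif_O_mult[OF unif_O_power that]]) simp
  have "unif_O 0 (\<lambda>\<alpha> r s. (f \<alpha> r s - (a0 r s + \<alpha> * a1 r s + \<alpha>\<^sup>2 * a2 r s))
     + (a0 r s + \<alpha> ^ 1 * a1 r s + \<alpha>\<^sup>2 * a2 r s))"
    by (intro unif_O_add p a unif_O_mono[OF f]) simp
  then show ?thesis by simp
qed

lemma jet_unif_O1:
  assumes "jet f (\<lambda>_ _. 0) a1 a2"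
  shows "unif_O 1 f"
proof -
  have a: "unif_O 0 (\<lambda>\<alpha>. a1)" "unif_O 0 (\<lambda>\<alpha>. a2)"
    and f: "unif_O 3 (\<lambda>\<alpha> r s. f \<alpha> r s - (0 + \<alpha> * a1 r s + \<alpha>\<^sup>2 * a2 r s))"
    using assms unfolding jet_def by auto
  have "unif_O 1 (\<lambda>\<alpha> r s. (f \<alpha> r s - (0 + \<alpha> * a1 r s + \<alpha>\<^sup>2 * a2 r s))
     + (\<alpha> ^ 1 * a1 r s + \<alpha>\<^sup>2 * a2 r s))"
    by (intro unif_O_add unif_O_mono[OF f] unif_O_mono[OF unif_O_mult[OF unif_O_power a(1)]]
          unif_O_mono[OF unif_O_mult[OF unif_O_power a(2)]]) simp_all
  then show ?thesis by simp
qed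

lemma jet_add:
  assumes "jet f a0 a1 a2" "jet g b0 b1 b2"
  shows "jet (\<lambda>\<alpha> r s. f \<alpha> r s + g \<alpha> r s) (\<lambda>r s. a0 r s + b0 r s) (\<lambda>r s. a1 r s + b1 r s)
     (\<lambda>r s. a2 r s + b2 r s)"
proof -
  have "unif_O 3 (\<lambda>\<alpha> r s. (f \<alpha> r s - (a0 r s + \<alpha> * a1 r s + \<alpha>\<^sup>2 * a2 r s)) +
      (g \<alpha> r s - (b0 r s + \<alpha> * b1 r s + \<alpha>\<^sup>2 * b2 r s)))"
    using assms unfolding jet_def by (intro unif_O_add) blast+
  then have "unif_O 3 (\<lambda>\<alpha> r s. f \<alpha> r s + g \<alpha> r s -
      ((a0 r s + b0 r s) + \<alpha> * (a1 r s + b1 r s) + \<alpha>\<^sup>2 * (a2 r s + b2 r s)))"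
    by (rule unif_O_eq) (simp add: algebra_simps)
  then show ?thesis using assms unfolding jet_def by (intro conjI unif_O_add) blast+
qed

lemma jet_mult:
  assumes "jet f a0 a1 a2" "jet g b0 b1 b2"
  shows "jet (\<lambda>\<alpha> r s. f \<alpha> r s * g \<alpha> r s) (\<lambda>r s. a0 r s * b0 r s)
     (\<lambda>r s. a0 r s * b1 r s + a1 r s * b0 r s)
     (\<lambda>r s. a0 r s * b2 r s + a1 r s * b1 r s + a2 r s * b0 r s)"
proof -
  note 0 = unif_O_mult[where k = 0 and l = 0, simplified]
  let ?F = "\<lambda>\<alpha> r s. a0 r s + \<alpha> * a1 r s + \<alpha>\<^sup>2 * a2 r s"
  let ?G = "\<lambda>\<alpha> r s. b0 r s + \<alpha> * b1 r s + \<alpha>\<^sup>2 * b2 r s"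
  have a: "unif_O 0 (\<lambda>\<alpha>. a0)" "unif_O 0 (\<lambda>\<alpha>. a1)" "unif_O 0 (\<lambda>\<alpha>. a2)"
    "unif_O 0 (\<lambda>\<alpha>. b0)" "unif_O 0 (\<lambda>\<alpha>. b1)" "unif_O 0 (\<lambda>\<alpha>. b2)"
    and f: "unif_O 3 (\<lambda>\<alpha> r s. f \<alpha> r s - ?F \<alpha> r s)" and g: "unif_O 3 (\<lambda>\<alpha> r s. g \<alpha> r s - ?G \<alpha> r s)"
    using assms unfolding jet_def by auto
  have \<alpha>: "unif_O 0 (\<lambda>\<alpha> r s. \<alpha>)" using unif_O_mono[OF unif_O_power[of 1], of 0] by simp
  have F: "unif_O 0 ?F"
    unfolding power2_eq_square by (intro unif_O_add 0 a \<alpha>)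
  have R: "unif_O 0 (\<lambda>\<alpha> r s. a1 r s * b2 r s + a2 r s * b1 r s + \<alpha> * (a2 r s * b2 r s))"
    by (intro unif_O_add 0 a \<alpha>)
  have G: "unif_O 0 g" by (rule jet_unif_O[OF assms(2)])
  \<comment> \<open>The error of the product splits as (f - F) g + F (g - G), plus the terms of the
    polynomial F G of degree 3 and 4 in \<alpha>, which the truncation drops.\<close>
  have "unif_O 3 (\<lambda>\<alpha> r s. (f \<alpha> r s - ?F \<alpha> r s) * g \<alpha> r s + ?F \<alpha> r s * (g \<alpha> r s - ?G \<alpha> r s)
     + \<alpha> ^ 3 * (a1 r s * b2 r s + a2 r s * b1 r s + \<alpha> * (a2 r s * b2 r s)))"
    using unif_O_mult[OF f G] unif_O_mult[OF F g] unif_O_mult[OF unif_O_power[of 3] R]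
    by (intro unif_O_add) (simp_all only: add_0 add_0_right)
  then have "unif_O 3 (\<lambda>\<alpha> r s. f \<alpha> r s * g \<alpha> r s - (a0 r s * b0 r s +
     \<alpha> * (a0 r s * b1 r s + a1 r s * b0 r s) +
     \<alpha>\<^sup>2 * (a0 r s * b2 r s + a1 r s * b1 r s + a2 r s * b0 r s)))"
    by (rule unif_O_eq) (simp add: algebra_simps power2_eq_square power3_eq_cube)
  then show ?thesis unfolding jet_def by (auto intro!: unif_O_add 0 a)
qed

lemma jet_const: "jet (\<lambda>_ _ _. c) (\<lambda>_ _. c) (\<lambda>_ _. 0) (\<lambda>_ _. 0)"
  by (simp add: jet_def)

lemma jet_diff:
  assumes "jet f a0 a1 a2" "jet g b0 b1 b2"
  shows "jet (\<lambda>\<alpha> r s. f \<alpha> r s - g \<alpha> r s) (\<lambda>r s. a0 r s - b0 r s) (\<lambda>r s. a1 r s - b1 r s)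
     (\<lambda>r s. a2 r s - b2 r s)"
  using jet_add[OF assms(1) jet_mult[OF jet_const[of "-1"] assms(2)]] by simp

lemma jet_const_in_s:
  assumes "(\<lambda>\<alpha>. h \<alpha> - (c0 + \<alpha> * c1 + \<alpha>\<^sup>2 * c2)) \<in> O[at_right 0](\<lambda>\<alpha>. \<alpha> ^ 3)"
  shows "jet (\<lambda>\<alpha> r s. h \<alpha>) (\<lambda>_ _. c0) (\<lambda>_ _. c1) (\<lambda>_ _. c2)"
  unfolding jet_def using unif_O_const_in_s[OF assms] by simp

text \<open>Here \<open>c1\<close> and \<open>c2\<close> are the Taylor coefficients of \<phi> at 0.
  Subtracting the quadratic polynomial leaves a function with derivative of order 2, which composed
  with an inner function of order \<alpha> is of order 3; the polynomial itself is handled by sums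
  and products of jets. The hypothesis concerns the derivative because that controls the function as
  well.\<close>

lemma jet_compose:
  assumes f: "jet f (\<lambda>_ _. 0) a1 a2"
    and der: "\<forall>\<^sub>F x in nhds 0. (\<phi> has_real_derivative \<phi>' x) (at x)"
    and bigo: "(\<lambda>x. \<phi>' x - (c1 + 2 * c2 * x)) \<in> O[at 0](\<lambda>x. x\<^sup>2)" and c1: "\<phi>' 0 = c1"
  shows "jet (\<lambda>\<alpha> r s. \<phi> (f \<alpha> r s)) (\<lambda>r s. \<phi> 0) (\<lambda>r s. c1 * a1 r s)
    (\<lambda>r s. c1 * a2 r s + c2 * (a1 r s)\<^sup>2)"
proof -
  have "\<forall>\<^sub>F x in nhds 0. ((\<lambda>x. \<phi> x - (c1 * x + c2 * x\<^sup>2)) has_real_derivative (\<phi>' x - (c1 + 2 * c2 * x))) (at x)"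
    using der by eventually_elim (auto intro!: derivative_eq_intros)
  from unif_O_compose[OF jet_unif_O1[OF f] _ this bigo]
  have "unif_O 3 (\<lambda>\<alpha> r s. \<phi> (f \<alpha> r s) - (c1 * f \<alpha> r s + c2 * (f \<alpha> r s)\<^sup>2) - \<phi> 0)"
    using c1 by (simp add: numeral_3_eq_3)
  note jet_add[OF jet_O3[OF this] jet_add[OF jet_add[OF jet_mult[OF jet_const[of c1] f]
     jet_mult[OF jet_const[of c2] jet_mult[OF f f]]] jet_const[of "\<phi> 0"]]]
  then show ?thesis by (simp add: power2_eq_square)
qed

text \<open>The numerator must be known up to order 4, as one order is lost. Stating boundedness of
  the coefficients through \<open>jet\<close> lets the standard rules discharge it.\<close>

lemma jet_divide_alpha:
  assumes "jet (\<lambda>\<alpha>. a0) a0 (\<lambda>_ _. 0) (\<lambda>_ _. 0)" "jet (\<lambda>\<alpha>. a1) a1 (\<lambda>_ _. 0) (\<lambda>_ _. 0)"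
    "jet (\<lambda>\<alpha>. a2) a2 (\<lambda>_ _. 0) (\<lambda>_ _. 0)"
    and f: "unif_O 4 (\<lambda>\<alpha> r s. f \<alpha> r s - \<alpha> * (a0 r s + \<alpha> * a1 r s + \<alpha>\<^sup>2 * a2 r s))"
  shows "jet (\<lambda>\<alpha> r s. f \<alpha> r s / \<alpha>) a0 a1 a2"
proof -
  have "unif_O 3 (\<lambda>\<alpha> r s. (f \<alpha> r s - \<alpha> * (a0 r s + \<alpha> * a1 r s + \<alpha>\<^sup>2 * a2 r s)) / \<alpha>)"
    using f by (intro unif_O_divide) (simp add: eval_nat_numeral)
  moreover have "\<forall>\<^sub>F \<alpha> in at_right 0. \<forall>r s. (f \<alpha> r s - \<alpha> * (a0 r s + \<alpha> * a1 r s + \<alpha>\<^sup>2 * a2 r s)) / \<alpha> =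
      f \<alpha> r s / \<alpha> - (a0 r s + \<alpha> * a1 r s + \<alpha>\<^sup>2 * a2 r s)"
    using eventually_at_right_less[of "0::real"] by eventually_elim (simp add: diff_divide_distrib)
  ultimately have "unif_O 3 (\<lambda>\<alpha> r s. f \<alpha> r s / \<alpha> - (a0 r s + \<alpha> * a1 r s + \<alpha>\<^sup>2 * a2 r s))"
    by (rule unif_O_cong[rotated])
  with assms show ?thesis unfolding jet_def by blast
qed

lemma jet_sin:
  assumes "jet f (\<lambda>_ _. 0) a1 a2"
  shows "jet (\<lambda>\<alpha> r s. sin (f \<alpha> r s)) (\<lambda>_ _. 0) a1 a2"
proof -
  have "\<forall>\<^sub>F x::real in nhds 0. (sin has_real_derivative cos x) (at x)"
    by (intro always_eventually allI DERIV_sin)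
  moreover have "(\<lambda>x::real. cos x - (1 + 2 * 0 * x)) \<in> O[at 0](\<lambda>x. x\<^sup>2)"
    by real_asymp
  ultimately show ?thesis
    using jet_compose[OF assms, of sin cos 1 0] by simp
qed

lemma jet_cos:
  assumes "jet f (\<lambda>_ _. 0) a1 a2"
  shows "jet (\<lambda>\<alpha> r s. cos (f \<alpha> r s)) (\<lambda>_ _. 1) (\<lambda>_ _. 0) (\<lambda>r s. - (a1 r s)\<^sup>2 / 2)"
proof -
  have "\<forall>\<^sub>F x::real in nhds 0. (cos has_real_derivative - sin x) (at x)"
    by (intro always_eventually allI DERIV_cos)
  moreover have "(\<lambda>x::real. - sin x - (0 + 2 * (- 1 / 2) * x)) \<in> O[at 0](\<lambda>x. x\<^sup>2)"
    by real_asymp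
  ultimately show ?thesis
    using jet_compose[OF assms, of cos "\<lambda>x. - sin x" 0 "- 1 / 2"] by simp
qed

section \<open>Expansions of the elementary functions of \<alpha>, \<open>r\<close> and
  \<open>s\<close>\<close>

lemma unif_O_bounded_s:
  assumes "\<And>r s. 0 \<le> r \<Longrightarrow> r < 1 \<Longrightarrow> ((\<lambda>s. a r s) has_real_derivative a' r s) (at s)"
    "\<And>r s. 0 \<le> r \<Longrightarrow> r < 1 \<Longrightarrow> \<bar>a r s\<bar> \<le> M" "\<And>r s. 0 \<le> r \<Longrightarrow> r < 1 \<Longrightarrow> \<bar>a' r s\<bar> \<le> M"
  shows "unif_O 0 (\<lambda>\<alpha>. a)"
  by (rule unif_OI[where C = M]) (auto intro!: always_eventually C1_boundI[where D = a'] assms)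

lemma unif_O_atoms: "unif_O 0 (\<lambda>\<alpha> r s. r)" "unif_O 0 (\<lambda>\<alpha> r s. sin s)" "unif_O 0 (\<lambda>\<alpha> r s. cos s)"
proof -
  show "unif_O 0 (\<lambda>\<alpha> r s. r)"
    by (rule unif_O_bounded_s[where M = 1 and a' = "\<lambda>_ _. 0"]) auto
  show "unif_O 0 (\<lambda>\<alpha> r. sin)"
    by (rule unif_O_bounded_s[where M = 1 and a' = "\<lambda>_ s. cos s"]) (auto intro: DERIV_sin)
  show "unif_O 0 (\<lambda>\<alpha> r. cos)"
    by (rule unif_O_bounded_s[where M = 1 and a' = "\<lambda>_ s. - sin s"]) (auto intro: DERIV_cos)
qed

lemma jet_r: "jet (\<lambda>\<alpha> r s. r) (\<lambda>r s. r) (\<lambda>_ _. 0) (\<lambda>_ _. 0)"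
  and jet_sin_s: "jet (\<lambda>\<alpha> r s. sin s) (\<lambda>r s. sin s) (\<lambda>_ _. 0) (\<lambda>_ _. 0)"
  and jet_cos_s: "jet (\<lambda>\<alpha> r s. cos s) (\<lambda>r s. cos s) (\<lambda>_ _. 0) (\<lambda>_ _. 0)"
  by (simp_all add: jet_def unif_O_atoms)

lemma jet_alpha: "jet (\<lambda>\<alpha> r s. \<alpha>) (\<lambda>_ _. 0) (\<lambda>_ _. 1) (\<lambda>_ _. 0)"
  by (rule jet_const_in_s) simp

lemma jet_sin_alpha: "jet (\<lambda>\<alpha> r s. sin \<alpha>) (\<lambda>_ _. 0) (\<lambda>_ _. 1) (\<lambda>_ _. 0)"
  by (rule jet_const_in_s) real_asymp

lemma jet_cos_alpha: "jet (\<lambda>\<alpha> r s. cos \<alpha>) (\<lambda>_ _. 1) (\<lambda>_ _. 0) (\<lambda>_ _. - 1 / 2)"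
  by (rule jet_const_in_s) real_asymp

lemmas jet_intros = jet_sin_alpha jet_cos_alpha jet_sin_s jet_cos_s jet_r jet_alpha jet_const
  jet_add jet_diff jet_mult

subsection \<open>Rotations\<close>

text \<open>The powers of \<open>K\<close> cycle through K, K^2, -K, -K^2, so odd terms follow the
  sine series and even terms minus the cosine series. At \<open>k = 0\<close> the latter contributes
  a spurious -K^2, which the summand \<open>K ** K\<close> in the conditional cancels.\<close>

lemma mat_power_coeff:
  fixes K :: "real^'n^'n"
  assumes "K ** (K ** K) = - K"
  shows "(1 / fact k) *\<^sub>R mat_power (t *\<^sub>R K) k =
    (if k = 0 then mat 1 + K ** K else 0) + (sin_coeff k * t ^ k) *\<^sub>R K + (- cos_coeff k * t ^ k) *\<^sub>R (K ** K)"
    (is "_ = ?R k")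
proof (induction k)
  case 0
  show ?case by (simp add: mat_power_def)
next
  case (Suc k)
  have "(1 / fact (Suc k)) *\<^sub>R mat_power (t *\<^sub>R K) (Suc k) =
      (t / real (Suc k)) *\<^sub>R (K ** ((1 / fact k) *\<^sub>R mat_power (t *\<^sub>R K) k))"
    by (simp add: mat_power_def matrix_scalar_ac flip: scalar_matrix_assoc)
  also have "\<dots> = (t / real (Suc k)) *\<^sub>R (K ** ?R k)"
    by (simp only: Suc.IH)
  also have "K ** ?R k = (sin_coeff k * t ^ k) *\<^sub>R (K ** K) + (cos_coeff k * t ^ k) *\<^sub>R K"
  proof -
    have "K ** (c *\<^sub>R (K ** K)) = - c *\<^sub>R K" "K ** (c *\<^sub>R K) = c *\<^sub>R (K ** K)" for c
      using assms by (simp_all add: matrix_scalar_ac flip: scalar_matrix_assoc)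
    moreover have "K ** (- A) = - (K ** A)" for A :: "real^'n^'n"
      by (metis matrix_scalar_ac scalar_matrix_assoc scaleR_minus1_left)
    ultimately show ?thesis
      using assms by (cases "k = 0") (simp_all add: matrix_add_ldistrib flip: add_uminus_conv_diff)
  qed
  also have "(t / real (Suc k)) *\<^sub>R \<dots> = ?R (Suc k)"
    by (simp add: sin_coeff_Suc cos_coeff_Suc scaleR_add_right mult_ac)
  finally show ?case .
qed

text \<open>Convergence of the matrix series needs no norm estimate: it is inherited from the scalar
  series of sine and cosine.\<close>

lemma mat_exp_rodrigues:
  fixes K :: "real^'n^'n"
  assumes "K ** (K ** K) = - K"
  shows "mat_exp (t *\<^sub>R K) = mat 1 + sin t *\<^sub>R K + (1 - cos t) *\<^sub>R (K ** K)"
proof -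
  have 1: "(\<lambda>k. if k = 0 then mat 1 + K ** K else 0) sums (mat 1 + K ** K)"
    using sums_single[of 0 "\<lambda>_. mat 1 + K ** K"] by simp
  have 2: "(\<lambda>k. (sin_coeff k * t ^ k) *\<^sub>R K) sums (sin t *\<^sub>R K)"
    using sin_converges[of t] by (intro sums_scaleR_left) simp
  have 3: "(\<lambda>k. (cos_coeff k * t ^ k) *\<^sub>R (K ** K)) sums (cos t *\<^sub>R (K ** K))"
    using cos_converges[of t] by (intro sums_scaleR_left) simp
  have "(\<lambda>k. (1 / fact k) *\<^sub>R mat_power (t *\<^sub>R K) k) sums
      (mat 1 + K ** K + sin t *\<^sub>R K - cos t *\<^sub>R (K ** K))"
    using sums_diff[OF sums_add[OF 1 2] 3] by (simp add: mat_power_coeff[OF assms])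
  then show ?thesis
    unfolding mat_exp_def by (simp add: sums_unique[symmetric] algebra_simps)
qed

lemma mat_exp_rodrigues_vector:
  fixes K :: "real^'n^'n"
  assumes "K ** (K ** K) = - K"
  shows "mat_exp (t *\<^sub>R K) *v y = y + sin t *\<^sub>R (K *v y) + (1 - cos t) *\<^sub>R (K *v (K *v y))"
  by (simp add: mat_exp_rodrigues[OF assms] matrix_vector_mult_add_rdistrib
      flip: scaleR_matrix_vector_assoc matrix_vector_mul_assoc)

text \<open>The matrix is the cross product with (\<epsilon> sin \<alpha>, 0, cos \<alpha>), a unit
  vector.\<close>

lemma X_mat_cube:
  assumes "\<epsilon>\<^sup>2 = 1"
  shows "X_mat \<epsilon> \<alpha> ** (X_mat \<epsilon> \<alpha> ** X_mat \<epsilon> \<alpha>) = - X_mat \<epsilon> \<alpha>"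
proof -
  have e: "\<epsilon> * \<epsilon> = 1" using assms by (simp add: power2_eq_square)
  have u: "cos \<alpha> * cos \<alpha> + sin \<alpha> * sin \<alpha> = 1"
    using sin_cos_squared_add3[of \<alpha>] by simp
  show ?thesis
    unfolding vec_eq_iff forall_3 matrix_matrix_mult_def X_mat_def F_mat_def G_mat_def
    apply (simp add: sum_3)
    using e u by (intro conjI; (algebra | simp add: algebra_simps))
qed

text \<open>The matrix is the cross product with (0, -\<epsilon> B, C), whose length is 1 by the
  second hypothesis; \<open>B_C_coeff_v\<close> provides it at the relevant time.\<close>

lemma Z_mat_cube:
  assumes "\<epsilon>\<^sup>2 = 1" "(B_coeff \<alpha> t)\<^sup>2 + (C_coeff \<alpha> t)\<^sup>2 = 1"
  shows "Z_mat \<epsilon> \<alpha> t ** (Z_mat \<epsilon> \<alpha> t ** Z_mat \<epsilon> \<alpha> t) = - Z_mat \<epsilon> \<alpha> t"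
  unfolding vec_eq_iff forall_3 matrix_matrix_mult_def Z_mat_def
  apply (simp add: sum_3)
  using assms by (intro conjI; algebra)

lemma X_mat_vector: "X_mat \<epsilon> \<alpha> *v y =
  vector [- cos \<alpha> * y$2, cos \<alpha> * y$1 - \<epsilon> * sin \<alpha> * y$3, \<epsilon> * sin \<alpha> * y$2]"
  by (simp add: vec_eq_iff forall_3 matrix_vector_mult_def X_mat_def F_mat_def G_mat_def sum_3)

lemma Z_mat_vector: "Z_mat \<epsilon> \<alpha> t *v y =
  vector [- C_coeff \<alpha> t * y$2 - \<epsilon> * B_coeff \<alpha> t * y$3, C_coeff \<alpha> t * y$1, \<epsilon> * B_coeff \<alpha> t * y$1]"
  by (simp add: vec_eq_iff forall_3 matrix_vector_mult_def Z_mat_def sum_3)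

text \<open>Vectors are kept in the form (\<epsilon> y1, \<epsilon> y2, y3). The rotations preserve
  this form and act on y1, y2, y3 by formulas free of \<epsilon>, so both signs are treated at
  once.\<close>

lemma exp_X_mat_vector:
  assumes "\<epsilon>\<^sup>2 = 1"
  shows "mat_exp (t *\<^sub>R X_mat (- \<epsilon>) \<alpha>) *v vector [\<epsilon> * y1, \<epsilon> * y2, y3] =
    vector [\<epsilon> * (y1 - sin t * cos \<alpha> * y2 - (1 - cos t) * cos \<alpha> * (cos \<alpha> * y1 + sin \<alpha> * y3)),
            \<epsilon> * (cos t * y2 + sin t * (cos \<alpha> * y1 + sin \<alpha> * y3)),
            y3 - sin t * sin \<alpha> * y2 - (1 - cos t) * sin \<alpha> * (cos \<alpha> * y1 + sin \<alpha> * y3)]"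
proof -
  have e: "\<epsilon> * \<epsilon> = 1" using assms by (simp add: power2_eq_square)
  have u: "cos \<alpha> * cos \<alpha> + sin \<alpha> * sin \<alpha> = 1"
    using sin_cos_squared_add3[of \<alpha>] by simp
  have "(- \<epsilon>)\<^sup>2 = 1" using assms by simp
  note * = mat_exp_rodrigues_vector[OF X_mat_cube[OF this]]
  show ?thesis
    unfolding * apply (simp add: X_mat_vector vec_eq_iff forall_3)
    using e u by (intro conjI; (algebra | simp add: algebra_simps))
qed

lemma exp_Z_mat_vector:
  assumes "\<epsilon>\<^sup>2 = 1" "(B_coeff \<alpha> v)\<^sup>2 + (C_coeff \<alpha> v)\<^sup>2 = 1"
  shows "mat_exp (t *\<^sub>R Z_mat (- \<epsilon>) \<alpha> v) *v vector [\<epsilon> * y1, \<epsilon> * y2, y3] =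
    (let h = B_coeff \<alpha> v * y3 - C_coeff \<alpha> v * y2 in
    vector [\<epsilon> * (cos t * y1 + sin t * h),
            \<epsilon> * (y2 + sin t * C_coeff \<alpha> v * y1 + (1 - cos t) * C_coeff \<alpha> v * h),
            y3 - sin t * B_coeff \<alpha> v * y1 - (1 - cos t) * B_coeff \<alpha> v * h])"
proof -
  have e: "\<epsilon> * \<epsilon> = 1" using assms by (simp add: power2_eq_square)
  have u: "B_coeff \<alpha> v * B_coeff \<alpha> v + C_coeff \<alpha> v * C_coeff \<alpha> v = 1"
    using assms by (simp add: power2_eq_square)
  have "(- \<epsilon>)\<^sup>2 = 1" using assms by simp
  note * = mat_exp_rodrigues_vector[OF Z_mat_cube[OF this assms(2)]]
  show ?thesis
    unfolding * apply (simp add: Z_mat_vector vec_eq_iff forall_3 Let_def)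
    using e u by (intro conjI; (algebra | simp add: algebra_simps))
qed

lemma exp_X_mat_north_pole:
  assumes "\<epsilon>\<^sup>2 = 1"
  shows "mat_exp (s *\<^sub>R X_mat \<epsilon> \<alpha>) *v north_pole =
    vector [\<epsilon> * (cos \<alpha> * sin \<alpha> * (1 - cos s)), \<epsilon> * (- sin \<alpha> * sin s), 1 - sin \<alpha> * sin \<alpha> * (1 - cos s)]"
proof -
  have e: "\<epsilon> * \<epsilon> = 1" using assms by (simp add: power2_eq_square)
  note * = mat_exp_rodrigues_vector[OF X_mat_cube[OF assms]]
  show ?thesis
    unfolding * apply (simp add: X_mat_vector north_pole_def vec_eq_iff forall_3)
    using e by simp
qed

subsection \<open>Rotation angles and coefficients near zero\<close>

text \<open>Half the deviation of \<open>v_fun\<close> from \<pi>; unlike \<open>v_fun\<close> it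
  tends to 0 with \<alpha>.\<close>

definition w_angle :: "real \<Rightarrow> real \<Rightarrow> real" where
  "w_angle \<alpha> s = arctan (sin s / (cos s + (cot \<alpha>)\<^sup>2))"

text \<open>
  The number \<open>sin \<alpha> * kappa \<alpha> s\<close> is the common denominator of \<open>B\<close> and \<open>C\<close> at \<open>v(s)\<close>, and also
  \<open>sin (\<Theta>(v(s)) / 4)\<close>. The factor \<open>sin \<alpha>\<close> is split off so that \<open>kappa\<close> stays smooth at \<open>\<alpha> = 0\<close>.
\<close>

definition rho :: "real \<Rightarrow> real \<Rightarrow> real" where
  "rho \<alpha> s = sin (w_angle \<alpha> s) / sin \<alpha>"

definition kappa :: "real \<Rightarrow> real \<Rightarrow> real" where
  "kappa \<alpha> s = sqrt (1 + (rho \<alpha> s * cos \<alpha>)\<^sup>2)"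

text \<open>For small positive \<alpha> this is \<Theta>(v(s)) / (4 \<alpha>), a quantity tending to
  1.\<close>

definition tau :: "real \<Rightarrow> real \<Rightarrow> real" where
  "tau \<alpha> s = arcsin (sin \<alpha> * kappa \<alpha> s) / \<alpha>"

text \<open>The deviation of \<open>theta_time\<close> from \<pi>, arranged so that every factor has
  a jet.\<close>

definition delta :: "real \<Rightarrow> real \<Rightarrow> real \<Rightarrow> real" where
  "delta \<alpha> r s = pi * (tau \<alpha> s - 1) - 2 * (1 + r) * (\<alpha> * tau \<alpha> s)"

text \<open>The deviation of \<open>psi_time\<close> from \<pi> - s.\<close>

definition eta :: "real \<Rightarrow> real \<Rightarrow> real \<Rightarrow> real" where
  "eta \<alpha> r s = 2 * (1 + r) * w_angle \<alpha> s - pi * (w_angle \<alpha> s / \<alpha>)"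

lemma v_fun_eq: "v_fun \<alpha> s = pi + 2 * w_angle \<alpha> s"
  by (simp add: v_fun_def w_angle_def)

lemma sin_half_v: "sin (v_fun \<alpha> s / 2) = cos (w_angle \<alpha> s)"
  and cos_half_v: "cos (v_fun \<alpha> s / 2) = - sin (w_angle \<alpha> s)"
  by (simp_all add: v_fun_eq add_divide_distrib sin_add cos_add)

lemma kappa_pos: "0 < kappa \<alpha> s"
  by (simp add: kappa_def add_pos_nonneg)

lemma kappa_square:
  assumes "sin \<alpha> > 0"
  shows "(sin \<alpha> * kappa \<alpha> s)\<^sup>2 = (cos (w_angle \<alpha> s))\<^sup>2 * (sin \<alpha>)\<^sup>2 + (sin (w_angle \<alpha> s))\<^sup>2"
proof -
  have "(kappa \<alpha> s)\<^sup>2 = 1 + (rho \<alpha> s * cos \<alpha>)\<^sup>2" by (simp add: kappa_def)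
  then have "(sin \<alpha> * kappa \<alpha> s)\<^sup>2 = (sin \<alpha>)\<^sup>2 + (sin (w_angle \<alpha> s))\<^sup>2 * (cos \<alpha>)\<^sup>2"
    using assms by (simp add: power_mult_distrib rho_def power_divide distrib_left)
  then show ?thesis by (simp add: cos_squared_eq algebra_simps)
qed

lemma sqrt_denominator:
  assumes "sin \<alpha> > 0"
  shows "sqrt ((sin (v_fun \<alpha> s / 2))\<^sup>2 * (sin \<alpha>)\<^sup>2 + (cos (v_fun \<alpha> s / 2))\<^sup>2) = sin \<alpha> * kappa \<alpha> s"
  using kappa_square[OF assms, of s] kappa_pos[of \<alpha> s] assms
  by (intro real_sqrt_unique) (simp_all add: sin_half_v cos_half_v)

lemma B_coeff_v:
  assumes "sin \<alpha> > 0"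
  shows "B_coeff \<alpha> (v_fun \<alpha> s) = cos (w_angle \<alpha> s) * (1 / kappa \<alpha> s)"
  using assms unfolding B_coeff_def sqrt_denominator[OF assms] by (simp add: sin_half_v)

lemma C_coeff_v:
  assumes "sin \<alpha> > 0"
  shows "C_coeff \<alpha> (v_fun \<alpha> s) = rho \<alpha> s * (1 / kappa \<alpha> s)"
  using assms unfolding C_coeff_def sqrt_denominator[OF assms] by (simp add: cos_half_v rho_def)

text \<open>If the radicand were zero, both coefficients would be 0 by the convention for division
  by zero. Its positivity is therefore the point to show, and \<open>sqrt_denominator\<close> gives
  it.\<close>

lemma B_C_coeff_v:
  assumes "sin \<alpha> > 0"
  shows "(B_coeff \<alpha> (v_fun \<alpha> s))\<^sup>2 + (C_coeff \<alpha> (v_fun \<alpha> s))\<^sup>2 = 1"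
proof -
  let ?S = "(sin (v_fun \<alpha> s / 2))\<^sup>2 * (sin \<alpha>)\<^sup>2 + (cos (v_fun \<alpha> s / 2))\<^sup>2"
  have "sqrt ?S > 0" unfolding sqrt_denominator[OF assms] using assms kappa_pos by simp
  then have "?S > 0" by simp
  then show ?thesis
    by (simp add: B_coeff_def C_coeff_def power_divide power_mult_distrib mult.commute flip: add_divide_distrib)
qed

text \<open>The argument of the arccosine is 1 - 2 m^2, where m is the sine of a quarter of the
  angle. It tends to 1, where arccosine is not differentiable; rewritten with arcsine, the angle is
  a smooth function of m near 0.\<close>

lemma Theta_angle_v:
  assumes "sin \<alpha> > 0"
  shows "Theta_angle \<alpha> (v_fun \<alpha> s) = 4 * arcsin (sin \<alpha> * kappa \<alpha> s)"
proof -
  let ?m = "sin \<alpha> * kappa \<alpha> s"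
  note m2 = kappa_square[OF assms, of s]
  have m0: "0 \<le> ?m" using assms kappa_pos[of \<alpha> s] by simp
  \<comment> \<open>In this form \<open>?m\<^sup>2\<close> is a convex combination of 1 and the
    squared sine of \<open>w_angle\<close>, hence at most 1.\<close>
  have "?m\<^sup>2 = (sin \<alpha>)\<^sup>2 + (sin (w_angle \<alpha> s))\<^sup>2 * (1 - (sin \<alpha>)\<^sup>2)"
    unfolding m2 by (simp add: cos_squared_eq algebra_simps)
  also have "\<dots> \<le> (sin \<alpha>)\<^sup>2 + 1 * (1 - (sin \<alpha>)\<^sup>2)"
    by (intro add_left_mono mult_right_mono) (simp_all add: abs_square_le_1)
  finally have m1: "?m \<le> 1" using power2_le_imp_le[of ?m 1] by simp
  have "(sin (v_fun \<alpha> s / 2))\<^sup>2 * cos (2 * \<alpha>) - (cos (v_fun \<alpha> s / 2))\<^sup>2 = 1 - 2 * ?m\<^sup>2"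
    unfolding m2 sin_half_v cos_half_v cos_double_sin[of \<alpha>] cos_squared_eq
    by (simp add: algebra_simps)
  also have "\<dots> = cos (2 * arcsin ?m)"
    using m0 m1 by (simp add: cos_double_sin)
  finally have "Theta_angle \<alpha> (v_fun \<alpha> s) = 2 * arccos (cos (2 * arcsin ?m))"
    by (simp add: Theta_angle_def)
  also have "\<dots> = 2 * (2 * arcsin ?m)"
    using arcsin_bounded[of ?m] m0 m1 arcsin_le_arcsin[of 0 ?m] by (subst arccos_cos) auto
  finally show ?thesis by simp
qed

lemma theta_time_eq:
  assumes "sin \<alpha> > 0" "\<alpha> > 0"
  shows "theta_time \<alpha> r s = pi + delta \<alpha> r s"
  using assms(2) by (simp add: theta_time_def Theta_angle_v[OF assms(1)] delta_def tau_def field_simps)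

lemma psi_time_eq: "\<alpha> > 0 \<Longrightarrow> psi_time \<alpha> r s = pi - (s - eta \<alpha> r s)"
  by (simp add: psi_time_def v_fun_eq eta_def field_simps)

section \<open>Expansions of the angles, the axis coefficients and their sines and cosines\<close>

lemma eventually_small:
  "\<forall>\<^sub>F \<alpha> in at_right (0::real). 0 < \<alpha> \<and> 0 < sin \<alpha> \<and> 0 < cos \<alpha> \<and> sin \<alpha> < cos \<alpha>"
proof -
  have "\<forall>\<^sub>F \<alpha> in at_right (0::real). 0 < \<alpha>" "\<forall>\<^sub>F \<alpha> in at_right (0::real). 0 < sin \<alpha>"
    "\<forall>\<^sub>F \<alpha> in at_right (0::real). 0 < cos \<alpha>" "\<forall>\<^sub>F \<alpha> in at_right (0::real). sin \<alpha> < cos \<alpha>"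
    by real_asymp+
  then show ?thesis by eventually_elim simp
qed

text \<open>Multiplying numerator and denominator by the square of tan \<alpha> removes the singular
  cotangent; the quotient \<open>q\<close> is then \<alpha>^2 sin s up to order 4, and arctan x - x
  contributes only order 6. Order 4 is wanted because the angle is later divided by
  \<alpha>.\<close>

lemma unif_O_w_angle: "unif_O 4 (\<lambda>\<alpha> r s. w_angle \<alpha> s - \<alpha>\<^sup>2 * sin s)"
proof -
  define q where "q \<alpha> s = (tan \<alpha>)\<^sup>2 * sin s * (1 / (1 + (tan \<alpha>)\<^sup>2 * cos s))" for \<alpha> s :: real
  have T: "unif_O 2 (\<lambda>\<alpha> r s. (tan \<alpha>)\<^sup>2)" and T4: "unif_O 4 (\<lambda>\<alpha> r s. (tan \<alpha>)\<^sup>2 - \<alpha>\<^sup>2)"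
    by (rule unif_O_const_in_s, real_asymp)+
  have TK: "unif_O 2 (\<lambda>\<alpha> r s. (tan \<alpha>)\<^sup>2 * cos s)"
    using unif_O_mult[OF T unif_O_atoms(3)] by simp
  have "\<forall>\<^sub>F x::real in nhds 0. ((\<lambda>x. 1 / (1 + x)) has_real_derivative - 1 / (1 + x)\<^sup>2) (at x)"
    by (rule eventually_nhds_in_open[of "{-1<..}", THEN eventually_mono])
       (auto intro!: derivative_eq_intros simp: power2_eq_square)
  moreover have "(\<lambda>x::real. - 1 / (1 + x)\<^sup>2) \<in> O[at 0](\<lambda>x. x ^ 0)"
    by real_asymp
  ultimately have inv: "unif_O 2 (\<lambda>\<alpha> r s. 1 / (1 + (tan \<alpha>)\<^sup>2 * cos s) - 1)"
    using unif_O_compose[OF TK, of "\<lambda>x. 1 / (1 + x)" _ 0] by simp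
  have inv0: "unif_O 0 (\<lambda>\<alpha> r s. 1 / (1 + (tan \<alpha>)\<^sup>2 * cos s))"
    using unif_O_add[OF unif_O_mono[OF inv, of 0] unif_O_const[of 1]] by simp
  \<comment> \<open>First the squared tangent is replaced by \<alpha>^2, then the reciprocal by 1;
    each replacement costs order 4.\<close>
  have "unif_O 4 (\<lambda>\<alpha> r s. ((tan \<alpha>)\<^sup>2 - \<alpha>\<^sup>2) * (sin s * (1 / (1 + (tan \<alpha>)\<^sup>2 * cos s))) +
     \<alpha>\<^sup>2 * (sin s * (1 / (1 + (tan \<alpha>)\<^sup>2 * cos s) - 1)))"
    using unif_O_mult[OF T4 unif_O_mult[OF unif_O_atoms(2) inv0]]
      unif_O_mult[OF unif_O_power[of 2] unif_O_mult[OF unif_O_atoms(2) inv]]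
    by (intro unif_O_add) simp_all
  then have q4: "unif_O 4 (\<lambda>\<alpha> r s. q \<alpha> s - \<alpha>\<^sup>2 * sin s)"
    by (rule unif_O_eq) (simp add: q_def algebra_simps diff_divide_distrib)
  have q2: "unif_O 2 (\<lambda>\<alpha> r s. q \<alpha> s)"
    using unif_O_add[OF unif_O_mono[OF q4, of 2] unif_O_mult[OF unif_O_power[of 2] unif_O_atoms(2), simplified]]
    by simp
  have "\<forall>\<^sub>F x::real in nhds 0. ((\<lambda>x. arctan x - x) has_real_derivative 1 / (1 + x\<^sup>2) - 1) (at x)"
    by (auto intro!: always_eventually derivative_eq_intros simp: field_simps)
  moreover have "(\<lambda>x::real. 1 / (1 + x\<^sup>2) - 1) \<in> O[at 0](\<lambda>x. x ^ 2)"
    by real_asymp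
  ultimately have "unif_O 6 (\<lambda>\<alpha> r s. arctan (q \<alpha> s) - q \<alpha> s)"
    using unif_O_compose[OF q2, of "\<lambda>x. arctan x - x" _ 2] by simp
  from unif_O_add[OF unif_O_mono[OF this, of 4] q4]
  have "unif_O 4 (\<lambda>\<alpha> r s. arctan (q \<alpha> s) - \<alpha>\<^sup>2 * sin s)" by simp
  then show ?thesis
  proof (rule unif_O_cong[rotated])
    show "\<forall>\<^sub>F \<alpha> in at_right 0. \<forall>(r::real) s. arctan (q \<alpha> s) - \<alpha>\<^sup>2 * sin s = w_angle \<alpha> s - \<alpha>\<^sup>2 * sin s"
      using eventually_small
    proof eventually_elim
      case (elim \<alpha>)
      then have "0 < tan \<alpha>" "tan \<alpha> < 1" by (auto simp: tan_def)
      then have T: "0 < (tan \<alpha>)\<^sup>2" "(tan \<alpha>)\<^sup>2 < 1" by (auto simp: abs_square_less_1)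
      have "(cot \<alpha>)\<^sup>2 = 1 / (tan \<alpha>)\<^sup>2"
        by (simp add: tan_def cot_def power_divide)
      then have "cos s + (cot \<alpha>)\<^sup>2 = (1 + (tan \<alpha>)\<^sup>2 * cos s) / (tan \<alpha>)\<^sup>2" for s
        using T(1) by (simp add: add_divide_distrib)
      then show ?case by (simp add: w_angle_def q_def mult.commute)
    qed
  qed
qed

lemma unif_O_w2: "unif_O 2 (\<lambda>\<alpha> r s. w_angle \<alpha> s)"
  using unif_O_add[OF unif_O_mono[OF unif_O_w_angle, of 2] unif_O_mult[OF unif_O_power[of 2] unif_O_atoms(2), simplified]]
  by simp

lemma jet_w: "jet (\<lambda>\<alpha> r s. w_angle \<alpha> s) (\<lambda>_ _. 0) (\<lambda>_ _. 0) (\<lambda>r s. sin s)"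
  using unif_O_mono[OF unif_O_w_angle, of 3] by (simp add: jet_def unif_O_atoms)

lemma jet_w_div: "jet (\<lambda>\<alpha> r s. w_angle \<alpha> s / \<alpha>) (\<lambda>_ _. 0) (\<lambda>r s. sin s) (\<lambda>_ _. 0)"
  using unif_O_w_angle
  by (intro jet_divide_alpha jet_const jet_sin_s) (simp add: power2_eq_square mult.assoc)

lemma jet_sin_w_div: "jet (\<lambda>\<alpha> r s. sin (w_angle \<alpha> s) / \<alpha>) (\<lambda>_ _. 0) (\<lambda>r s. sin s) (\<lambda>_ _. 0)"
proof -
  have "\<forall>\<^sub>F x::real in nhds 0. ((\<lambda>x. sin x - x) has_real_derivative cos x - 1) (at x)"
    by (auto intro!: always_eventually derivative_eq_intros)
  moreover have "(\<lambda>x::real. cos x - 1) \<in> O[at 0](\<lambda>x. x ^ 2)"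
    by real_asymp
  ultimately have "unif_O 6 (\<lambda>\<alpha> r s. sin (w_angle \<alpha> s) - w_angle \<alpha> s)"
    using unif_O_compose[OF unif_O_w2, of "\<lambda>x. sin x - x" _ 2] by simp
  from unif_O_add[OF unif_O_mono[OF this, of 4] unif_O_w_angle]
  have "unif_O 4 (\<lambda>\<alpha> r s. sin (w_angle \<alpha> s) - \<alpha>\<^sup>2 * sin s)" by simp
  then show ?thesis
    by (intro jet_divide_alpha jet_const jet_sin_s) (simp add: power2_eq_square mult.assoc)
qed

lemma jet_rho: "jet (\<lambda>\<alpha> r s. rho \<alpha> s) (\<lambda>_ _. 0) (\<lambda>r s. sin s) (\<lambda>_ _. 0)"
proof -
  have "jet (\<lambda>\<alpha> r s. \<alpha> / sin \<alpha>) (\<lambda>_ _. 1) (\<lambda>_ _. 0) (\<lambda>_ _. 1 / 6)"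
    by (rule jet_const_in_s) real_asymp
  from jet_mult[OF jet_sin_w_div this]
  have "jet (\<lambda>\<alpha> r s. sin (w_angle \<alpha> s) / \<alpha> * (\<alpha> / sin \<alpha>)) (\<lambda>_ _. 0) (\<lambda>r s. sin s) (\<lambda>_ _. 0)"
    by simp
  then show ?thesis
    by (rule jet_eventually_cong)
       (use eventually_small in eventually_elim, simp add: rho_def)
qed

lemma jet_rho_cos_square: "jet (\<lambda>\<alpha> r s. (rho \<alpha> s * cos \<alpha>)\<^sup>2) (\<lambda>_ _. 0) (\<lambda>_ _. 0) (\<lambda>r s. (sin s)\<^sup>2)"
  unfolding power2_eq_square
  by (rule jet_cong, (rule jet_rho jet_cos_alpha jet_mult)+) simp_all

lemma jet_kappa: "jet (\<lambda>\<alpha> r s. kappa \<alpha> s) (\<lambda>_ _. 1) (\<lambda>_ _. 0) (\<lambda>r s. (sin s)\<^sup>2 / 2)"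
proof -
  have "\<forall>\<^sub>F x::real in nhds 0. ((\<lambda>x. sqrt (1 + x)) has_real_derivative 1 / (2 * sqrt (1 + x))) (at x)"
    by (rule eventually_nhds_in_open[of "{-1<..}", THEN eventually_mono])
       (auto intro!: derivative_eq_intros simp: field_simps)
  moreover have "(\<lambda>x::real. 1 / (2 * sqrt (1 + x)) - (1 / 2 + 2 * (- 1 / 8) * x)) \<in> O[at 0](\<lambda>x. x\<^sup>2)"
    by real_asymp
  ultimately show ?thesis unfolding kappa_def
    using jet_compose[OF jet_rho_cos_square, of "\<lambda>x. sqrt (1 + x)" _ "1 / 2" "- 1 / 8"] by simp
qed

text \<open>The reciprocal root is expanded directly in the squared quantity under the root, which
  has zero constant term as \<open>jet_compose\<close> requires; -1/2 and 3/8 are the binomial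
  coefficients.\<close>

lemma jet_inverse_kappa: "jet (\<lambda>\<alpha> r s. 1 / kappa \<alpha> s) (\<lambda>_ _. 1) (\<lambda>_ _. 0) (\<lambda>r s. - (sin s)\<^sup>2 / 2)"
proof -
  have "\<forall>\<^sub>F x::real in nhds 0. ((\<lambda>x. 1 / sqrt (1 + x)) has_real_derivative - 1 / (2 * (1 + x) * sqrt (1 + x))) (at x)"
    by (rule eventually_nhds_in_open[of "{-1<..}", THEN eventually_mono])
       (auto intro!: derivative_eq_intros simp: field_simps)
  moreover have "(\<lambda>x::real. - 1 / (2 * (1 + x) * sqrt (1 + x)) - (- 1 / 2 + 2 * (3 / 8) * x)) \<in> O[at 0](\<lambda>x. x\<^sup>2)"
    by real_asymp
  ultimately show ?thesis unfolding kappa_def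
    using jet_compose[OF jet_rho_cos_square, of "\<lambda>x. 1 / sqrt (1 + x)" _ "- 1 / 2" "3 / 8"] by simp
qed

text \<open>Because of the division by \<alpha>, arcsine is expanded to m + m^3 / 6 with an error of
  order 4. The 1/6 from the cubic term cancels the -1/6 from sin \<alpha> / \<alpha>.\<close>

lemma jet_tau: "jet (\<lambda>\<alpha> r s. tau \<alpha> s) (\<lambda>_ _. 1) (\<lambda>_ _. 0) (\<lambda>r s. (sin s)\<^sup>2 / 2)"
proof -
  let ?m = "\<lambda>\<alpha> s. sin \<alpha> * kappa \<alpha> s" and ?\<mu> = "\<lambda>\<alpha> s. (sin \<alpha> / \<alpha>) * kappa \<alpha> s"
  have "jet (\<lambda>\<alpha> r s. ?m \<alpha> s) (\<lambda>_ _. 0) (\<lambda>_ _. 1) (\<lambda>_ _. 0)"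
    by (rule jet_cong, (rule jet_kappa jet_sin_alpha jet_mult)+) simp_all
  note m = jet_unif_O1[OF this]
  have "\<forall>\<^sub>F x::real in nhds 0. ((\<lambda>x. arcsin x - x - x ^ 3 / 6) has_real_derivative
      1 / sqrt (1 - x\<^sup>2) - 1 - x\<^sup>2 / 2) (at x)"
    by (rule eventually_nhds_in_open[of "{-1<..<1}", THEN eventually_mono])
       (auto intro!: derivative_eq_intros simp: inverse_eq_divide)
  moreover have "(\<lambda>x::real. 1 / sqrt (1 - x\<^sup>2) - 1 - x\<^sup>2 / 2) \<in> O[at 0](\<lambda>x. x ^ 3)"
    by real_asymp
  ultimately have "unif_O (Suc 3) (\<lambda>\<alpha> r s. arcsin (?m \<alpha> s) - ?m \<alpha> s - ?m \<alpha> s ^ 3 / 6)"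
    using unif_O_compose[OF m, of "\<lambda>x. arcsin x - x - x ^ 3 / 6" _ 3] by simp
  note E = jet_O3[OF unif_O_divide[OF this]]
  have \<sigma>: "jet (\<lambda>\<alpha> r s. sin \<alpha> / \<alpha>) (\<lambda>_ _. 1) (\<lambda>_ _. 0) (\<lambda>_ _. - 1 / 6)"
    by (rule jet_const_in_s) real_asymp
  have "jet (\<lambda>\<alpha> r s. ?\<mu> \<alpha> s) (\<lambda>_ _. 1) (\<lambda>_ _. 0) (\<lambda>r s. (sin s)\<^sup>2 / 2 - 1 / 6)"
    by (rule jet_cong, (rule jet_kappa \<sigma> jet_mult)+) simp_all
  note \<mu> = this
  \<comment> \<open>With \<mu> = m / \<alpha>, the cubic term m^3 / (6 \<alpha>) becomes \<alpha>^2
    \<mu>^3 / 6, a product of jets.\<close>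
  have "jet (\<lambda>\<alpha> r s. (arcsin (?m \<alpha> s) - ?m \<alpha> s - ?m \<alpha> s ^ 3 / 6) / \<alpha> + ?\<mu> \<alpha> s +
     1 / 6 * (\<alpha> * \<alpha> * (?\<mu> \<alpha> s * ?\<mu> \<alpha> s * ?\<mu> \<alpha> s))) (\<lambda>_ _. 1) (\<lambda>_ _. 0) (\<lambda>r s. (sin s)\<^sup>2 / 2)"
    by (rule jet_cong, (rule E \<mu> jet_alpha jet_const jet_add jet_mult)+) simp_all
  then show ?thesis
    by (rule jet_eventually_cong)
       (use eventually_small in eventually_elim, simp add: tau_def field_simps power3_eq_cube)
qed

lemma jet_delta: "jet delta (\<lambda>_ _. 0) (\<lambda>r s. - 2 * (1 + r)) (\<lambda>r s. pi * (sin s)\<^sup>2 / 2)"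
proof -
  have "jet (\<lambda>\<alpha> r s. pi * (tau \<alpha> s - 1) - 2 * (1 + r) * (\<alpha> * tau \<alpha> s))
      (\<lambda>_ _. 0) (\<lambda>r s. - 2 * (1 + r)) (\<lambda>r s. pi * (sin s)\<^sup>2 / 2)"
    by (rule jet_cong, (rule jet_tau jet_intros)+) simp_all
  then show ?thesis by (simp add: delta_def[abs_def])
qed

lemma jet_eta: "jet eta (\<lambda>_ _. 0) (\<lambda>r s. - pi * sin s) (\<lambda>r s. 2 * (1 + r) * sin s)"
proof -
  have "jet (\<lambda>\<alpha> r s. 2 * (1 + r) * w_angle \<alpha> s - pi * (w_angle \<alpha> s / \<alpha>))
      (\<lambda>_ _. 0) (\<lambda>r s. - pi * sin s) (\<lambda>r s. 2 * (1 + r) * sin s)"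
    by (rule jet_cong, (rule jet_w jet_w_div jet_intros)+) simp_all
  then show ?thesis by (simp add: eta_def[abs_def])
qed

lemma jet_B_coeff: "jet (\<lambda>\<alpha> r s. B_coeff \<alpha> (v_fun \<alpha> s)) (\<lambda>_ _. 1) (\<lambda>_ _. 0) (\<lambda>r s. - (sin s)\<^sup>2 / 2)"
proof -
  have "jet (\<lambda>\<alpha> r s. cos (w_angle \<alpha> s) * (1 / kappa \<alpha> s)) (\<lambda>_ _. 1) (\<lambda>_ _. 0) (\<lambda>r s. - (sin s)\<^sup>2 / 2)"
    by (rule jet_cong, (rule jet_inverse_kappa jet_cos[OF jet_w] jet_mult)+) simp_all
  then show ?thesis
    by (rule jet_eventually_cong)
       (use eventually_small in eventually_elim, simp add: B_coeff_v)
qed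

lemma jet_C_coeff: "jet (\<lambda>\<alpha> r s. C_coeff \<alpha> (v_fun \<alpha> s)) (\<lambda>_ _. 0) (\<lambda>r s. sin s) (\<lambda>_ _. 0)"
proof -
  have "jet (\<lambda>\<alpha> r s. rho \<alpha> s * (1 / kappa \<alpha> s)) (\<lambda>_ _. 0) (\<lambda>r s. sin s) (\<lambda>_ _. 0)"
    by (rule jet_cong, (rule jet_inverse_kappa jet_rho jet_mult)+) simp_all
  then show ?thesis
    by (rule jet_eventually_cong)
       (use eventually_small in eventually_elim, simp add: C_coeff_v)
qed

lemma jet_sin_theta: "jet (\<lambda>\<alpha> r s. sin (theta_time \<alpha> r s)) (\<lambda>_ _. 0) (\<lambda>r s. 2 * (1 + r)) (\<lambda>r s. - pi * (sin s)\<^sup>2 / 2)"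
proof -
  have "jet (\<lambda>\<alpha> r s. - 1 * sin (delta \<alpha> r s)) (\<lambda>_ _. 0) (\<lambda>r s. 2 * (1 + r)) (\<lambda>r s. - pi * (sin s)\<^sup>2 / 2)"
    by (rule jet_cong, (rule jet_sin[OF jet_delta] jet_const jet_mult)+) simp_all
  then show ?thesis
    by (rule jet_eventually_cong)
       (use eventually_small in eventually_elim, simp add: theta_time_eq sin_add)
qed

lemma jet_cos_theta: "jet (\<lambda>\<alpha> r s. cos (theta_time \<alpha> r s)) (\<lambda>_ _. - 1) (\<lambda>_ _. 0) (\<lambda>r s. 2 * (1 + r)\<^sup>2)"
proof -
  have "jet (\<lambda>\<alpha> r s. - 1 * cos (delta \<alpha> r s)) (\<lambda>_ _. - 1) (\<lambda>_ _. 0) (\<lambda>r s. 2 * (1 + r)\<^sup>2)"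
    by (rule jet_cong, (rule jet_cos[OF jet_delta] jet_const jet_mult)+)
       (simp_all add: power2_eq_square algebra_simps)
  then show ?thesis
    by (rule jet_eventually_cong)
       (use eventually_small in eventually_elim, simp add: theta_time_eq cos_add)
qed

text \<open>The angle is not near a fixed number, as \<open>s\<close> is arbitrary. The subtraction
  formula isolates \<open>s\<close>, so only the small \<open>eta\<close> is Taylor expanded;
  \<open>s\<close> enters just through its sine and cosine, which keeps the bounds uniform on the
  whole line.\<close>

lemma jet_sin_psi: "jet (\<lambda>\<alpha> r s. sin (psi_time \<alpha> r s)) (\<lambda>r s. sin s) (\<lambda>r s. pi * sin s * cos s)
    (\<lambda>r s. - pi\<^sup>2 * (sin s)^3 / 2 - 2 * (1 + r) * sin s * cos s)"
proof -
  have "jet (\<lambda>\<alpha> r s. sin s * cos (eta \<alpha> r s) - cos s * sin (eta \<alpha> r s))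
      (\<lambda>r s. sin s) (\<lambda>r s. pi * sin s * cos s)
      (\<lambda>r s. - pi\<^sup>2 * (sin s)^3 / 2 - 2 * (1 + r) * sin s * cos s)"
    by (rule jet_cong, (rule jet_sin_s jet_cos_s jet_sin[OF jet_eta] jet_cos[OF jet_eta] jet_mult jet_diff)+)
       (simp_all add: power2_eq_square power3_eq_cube algebra_simps)
  then show ?thesis
    by (rule jet_eventually_cong)
       (use eventually_small in eventually_elim, simp add: psi_time_eq sin_diff)
qed

lemma jet_cos_psi: "jet (\<lambda>\<alpha> r s. cos (psi_time \<alpha> r s)) (\<lambda>r s. - cos s) (\<lambda>r s. pi * (sin s)\<^sup>2)
    (\<lambda>r s. pi\<^sup>2 * (sin s)\<^sup>2 * cos s / 2 - 2 * (1 + r) * (sin s)\<^sup>2)"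
proof -
  have "jet (\<lambda>\<alpha> r s. - 1 * (cos s * cos (eta \<alpha> r s) + sin s * sin (eta \<alpha> r s)))
      (\<lambda>r s. - cos s) (\<lambda>r s. pi * (sin s)\<^sup>2)
      (\<lambda>r s. pi\<^sup>2 * (sin s)\<^sup>2 * cos s / 2 - 2 * (1 + r) * (sin s)\<^sup>2)"
    by (rule jet_cong, (rule jet_sin_s jet_cos_s jet_sin[OF jet_eta] jet_cos[OF jet_eta] jet_const jet_mult jet_add)+)
       (simp_all add: power2_eq_square algebra_simps)
  then show ?thesis
    by (rule jet_eventually_cong)
       (use eventually_small in eventually_elim, simp add: psi_time_eq cos_diff)
qed

section \<open>The three rotations applied to the north pole\<close>

lemma chi_expansion:
  obtains x1 x2 x3 where
    "\<forall>\<^sub>F \<alpha> in at_right 0. \<forall>\<epsilon>\<in>{1, - 1}. \<forall>r s.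
       chi \<epsilon> \<alpha> r s = vector [\<epsilon> * x1 \<alpha> r s, \<epsilon> * x2 \<alpha> r s, x3 \<alpha> r s]"
    "jet x1 (\<lambda>r s. f0_plus s r $ 1) (\<lambda>r s. f1_plus s r $ 1) (\<lambda>r s. f2_plus s r $ 1)"
    "jet x2 (\<lambda>r s. f0_plus s r $ 2) (\<lambda>r s. f1_plus s r $ 2) (\<lambda>r s. f2_plus s r $ 2)"
    "jet x3 (\<lambda>r s. f0_plus s r $ 3) (\<lambda>r s. f1_plus s r $ 3) (\<lambda>r s. f2_plus s r $ 3)"
proof -
  \<comment> \<open>The families p, y and x are the components after the first, second and third
    rotation, with \<epsilon> stripped off; \<open>h\<close> and \<open>g\<close> are the linear
    forms recurring in the formulas for the second and third.\<close>
  define p1 where "p1 = (\<lambda>(\<alpha>::real) (r::real) s. cos \<alpha> * sin \<alpha> * (1 - cos s))"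
  define p2 where "p2 = (\<lambda>(\<alpha>::real) (r::real) s. - 1 * sin \<alpha> * sin s)"
  define p3 where "p3 = (\<lambda>(\<alpha>::real) (r::real) s. 1 - sin \<alpha> * sin \<alpha> * (1 - cos s))"
  define b where "b = (\<lambda>(\<alpha>::real) (r::real) s. B_coeff \<alpha> (v_fun \<alpha> s))"
  define c where "c = (\<lambda>(\<alpha>::real) (r::real) s. C_coeff \<alpha> (v_fun \<alpha> s))"
  define st where "st = (\<lambda>(\<alpha>::real) (r::real) s. sin (theta_time \<alpha> r s))"
  define ct where "ct = (\<lambda>(\<alpha>::real) (r::real) s. cos (theta_time \<alpha> r s))"
  define sp where "sp = (\<lambda>(\<alpha>::real) (r::real) s. sin (psi_time \<alpha> r s))"
  define cp where "cp = (\<lambda>(\<alpha>::real) (r::real) s. cos (psi_time \<alpha> r s))"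
  define h where "h = (\<lambda>\<alpha> r s. b \<alpha> r s * p3 \<alpha> r s - c \<alpha> r s * p2 \<alpha> r s)"
  define y1 where "y1 = (\<lambda>\<alpha> r s. ct \<alpha> r s * p1 \<alpha> r s + st \<alpha> r s * h \<alpha> r s)"
  define y2 where "y2 = (\<lambda>\<alpha> r s. p2 \<alpha> r s + st \<alpha> r s * c \<alpha> r s * p1 \<alpha> r s + (1 - ct \<alpha> r s) * c \<alpha> r s * h \<alpha> r s)"
  define y3 where "y3 = (\<lambda>\<alpha> r s. p3 \<alpha> r s - st \<alpha> r s * b \<alpha> r s * p1 \<alpha> r s - (1 - ct \<alpha> r s) * b \<alpha> r s * h \<alpha> r s)"
  define g where "g = (\<lambda>\<alpha> r s. cos \<alpha> * y1 \<alpha> r s + sin \<alpha> * y3 \<alpha> r s)"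
  define x1 where "x1 = (\<lambda>\<alpha> r s. y1 \<alpha> r s - sp \<alpha> r s * cos \<alpha> * y2 \<alpha> r s - (1 - cp \<alpha> r s) * cos \<alpha> * g \<alpha> r s)"
  define x2 where "x2 = (\<lambda>\<alpha> r s. cp \<alpha> r s * y2 \<alpha> r s + sp \<alpha> r s * g \<alpha> r s)"
  define x3 where "x3 = (\<lambda>\<alpha> r s. y3 \<alpha> r s - sp \<alpha> r s * sin \<alpha> * y2 \<alpha> r s - (1 - cp \<alpha> r s) * sin \<alpha> * g \<alpha> r s)"
  have jp1: "jet p1 (\<lambda>_ _. 0) (\<lambda>r s. 1 - cos s) (\<lambda>_ _. 0)"
    unfolding p1_def by (rule jet_cong, (rule jet_intros)+) simp_all
  have jp2: "jet p2 (\<lambda>_ _. 0) (\<lambda>r s. - sin s) (\<lambda>_ _. 0)"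
    unfolding p2_def by (rule jet_cong, (rule jet_intros)+) simp_all
  have jp3: "jet p3 (\<lambda>_ _. 1) (\<lambda>_ _. 0) (\<lambda>r s. cos s - 1)"
    unfolding p3_def by (rule jet_cong, (rule jet_intros)+) simp_all
  note j = jp1 jp2 jp3 jet_B_coeff[folded b_def] jet_C_coeff[folded c_def]
     jet_sin_theta[folded st_def] jet_cos_theta[folded ct_def]
     jet_sin_psi[folded sp_def] jet_cos_psi[folded cp_def]
  have jh: "jet h (\<lambda>_ _. 1) (\<lambda>_ _. 0) (\<lambda>r s. (sin s)\<^sup>2 / 2 + cos s - 1)"
    unfolding h_def by (rule jet_cong, (rule j jet_intros)+) (simp_all add: power2_eq_square algebra_simps)
  \<comment> \<open>Each intermediate vector is brought to simplified coefficients before the next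
    rotation. The second rotation is nearly a half-turn and carries the point close to the south
    pole.\<close>
  have jy1: "jet y1 (\<lambda>_ _. 0) (\<lambda>r s. 2 * (1 + r) - 1 + cos s) (\<lambda>r s. - pi * (sin s)\<^sup>2 / 2)"
    unfolding y1_def by (rule jet_cong, (rule j jh jet_intros)+) (simp_all add: power2_eq_square algebra_simps)
  have jy2: "jet y2 (\<lambda>_ _. 0) (\<lambda>r s. sin s) (\<lambda>_ _. 0)"
    unfolding y2_def by (rule jet_cong, (rule j jh jet_intros)+) (simp_all add: power2_eq_square algebra_simps)
  have jy3: "jet y3 (\<lambda>_ _. - 1) (\<lambda>_ _. 0) (\<lambda>r s. (1 - cos s) * (1 - 2 * (1 + r)) + 2 * (1 + r)\<^sup>2)"
    unfolding y3_def by (rule jet_cong, (rule j jh jet_intros)+) (simp_all add: power2_eq_square algebra_simps)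
  have jg: "jet g (\<lambda>_ _. 0) (\<lambda>r s. 2 * r + cos s) (\<lambda>r s. - pi * (sin s)\<^sup>2 / 2)"
    unfolding g_def by (rule jet_cong, (rule jy1 jy3 jet_intros)+) (simp_all add: power2_eq_square algebra_simps)
  note jj = j jy1 jy2 jy3 jg jet_intros
  have c2: "cos (s * 2) = 2 * (cos s * cos s) - 1" for s :: real
    using cos_double_cos[of s] by (simp add: power2_eq_square mult.commute)
  \<comment> \<open>As rewrite rules these eliminate squares of \<open>sin s\<close>, giving a
    normal form modulo the Pythagorean identity; the second form catches squares inside right-nested
    products.\<close>
  have sq: "sin s * sin s = 1 - cos s * cos s" "sin s * (sin s * z) = z - cos s * (cos s * z)" for s z :: real
  proof -
    show "sin s * sin s = 1 - cos s * cos s" using sin_cos_squared_add3[of s] by linarith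
    then show "sin s * (sin s * z) = z - cos s * (cos s * z)"
      by (simp only: mult.assoc[symmetric]) (simp add: algebra_simps)
  qed
  have jx1: "jet x1 (\<lambda>r s. f0_plus s r $ 1) (\<lambda>r s. f1_plus s r $ 1) (\<lambda>r s. f2_plus s r $ 1)"
    unfolding x1_def by (rule jet_cong, (rule jj)+)
      (simp_all add: f0_plus_def f1_plus_def f2_plus_def power2_eq_square power3_eq_cube algebra_simps sq add_divide_distrib diff_divide_distrib)
  have jx2: "jet x2 (\<lambda>r s. f0_plus s r $ 2) (\<lambda>r s. f1_plus s r $ 2) (\<lambda>r s. f2_plus s r $ 2)"
    unfolding x2_def by (rule jet_cong, (rule jj)+)
      (simp_all add: f0_plus_def f1_plus_def f2_plus_def power2_eq_square power3_eq_cube c2 algebra_simps sq add_divide_distrib diff_divide_distrib)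
  have jx3: "jet x3 (\<lambda>r s. f0_plus s r $ 3) (\<lambda>r s. f1_plus s r $ 3) (\<lambda>r s. f2_plus s r $ 3)"
    unfolding x3_def by (rule jet_cong, (rule jj)+)
      (simp_all add: f0_plus_def f1_plus_def f2_plus_def power2_eq_square power3_eq_cube algebra_simps sq add_divide_distrib diff_divide_distrib)
  have "\<forall>\<^sub>F \<alpha> in at_right 0. \<forall>\<epsilon>\<in>{1, - 1}. \<forall>r s.
       chi \<epsilon> \<alpha> r s = vector [\<epsilon> * x1 \<alpha> r s, \<epsilon> * x2 \<alpha> r s, x3 \<alpha> r s]"
    using eventually_small
  proof eventually_elim
    case (elim \<alpha>)
    show ?case
    proof (intro ballI allI)
      fix \<epsilon> r s :: real assume "\<epsilon> \<in> {1, - 1}"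
      then have \<epsilon>: "\<epsilon>\<^sup>2 = 1" by auto
      have BC: "(B_coeff \<alpha> (v_fun \<alpha> s))\<^sup>2 + (C_coeff \<alpha> (v_fun \<alpha> s))\<^sup>2 = 1"
        using elim by (intro B_C_coeff_v) simp
      have 1: "mat_exp (s *\<^sub>R X_mat \<epsilon> \<alpha>) *v north_pole =
          vector [\<epsilon> * p1 \<alpha> r s, \<epsilon> * p2 \<alpha> r s, p3 \<alpha> r s]"
        by (simp add: exp_X_mat_north_pole[OF \<epsilon>] p1_def p2_def p3_def)
      have 2: "mat_exp (theta_time \<alpha> r s *\<^sub>R Z_mat (- \<epsilon>) \<alpha> (v_fun \<alpha> s)) *v \<dots> =
          vector [\<epsilon> * y1 \<alpha> r s, \<epsilon> * y2 \<alpha> r s, y3 \<alpha> r s]"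
        by (simp add: exp_Z_mat_vector[OF \<epsilon> BC] y1_def y2_def y3_def h_def st_def ct_def b_def c_def Let_def)
      have 3: "mat_exp (psi_time \<alpha> r s *\<^sub>R X_mat (- \<epsilon>) \<alpha>) *v \<dots> =
          vector [\<epsilon> * x1 \<alpha> r s, \<epsilon> * x2 \<alpha> r s, x3 \<alpha> r s]"
        by (simp add: exp_X_mat_vector[OF \<epsilon>] x1_def x2_def x3_def g_def sp_def cp_def)
      show "chi \<epsilon> \<alpha> r s = vector [\<epsilon> * x1 \<alpha> r s, \<epsilon> * x2 \<alpha> r s, x3 \<alpha> r s]"
        unfolding chi_def by (simp only: matrix_vector_mul_assoc[symmetric] 1 2 3)
    qed
  qed
  then show ?thesis using jx1 jx2 jx3 by (rule that)
qed

section \<open>From components to vectors and their derivatives\<close>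

lemma has_vector_derivative_vector_3:
  assumes "(a has_real_derivative a') (at s)" "(b has_real_derivative b') (at s)"
    "(c has_real_derivative c') (at s)"
  shows "((\<lambda>s. vector [a s, b s, c s] :: real^3) has_vector_derivative vector [a', b', c']) (at s)"
proof -
  have v: "vector [x, y, z] = x *\<^sub>R axis 1 1 + y *\<^sub>R axis 2 1 + z *\<^sub>R (axis 3 1 :: real^3)" for x y z
    by (simp add: vec_eq_iff forall_3 axis_def)
  show ?thesis unfolding v
    using assms unfolding has_real_derivative_iff_has_vector_derivative
    by (intro has_vector_derivative_add bounded_linear.has_vector_derivative[OF bounded_linear_scaleR_left])
qed

lemma norm_vector_3: "norm (vector [a, b, c] :: real^3) \<le> \<bar>a\<bar> + \<bar>b\<bar> + \<bar>c\<bar>"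
  using norm_le_l1_cart[of "vector [a, b, c] :: real^3"] by (simp add: sum_3)

lemma sign_diag_vector:
  assumes "\<epsilon> \<in> {1, - 1}"
  shows "sign_diag \<epsilon> *v y = vector [\<epsilon> * y $ 1, \<epsilon> * y $ 2, y $ 3]"
proof (cases "\<epsilon> = 1")
  case True
  then show ?thesis by (simp add: sign_diag_def vec_eq_iff forall_3)
next
  case False
  with assms show ?thesis
    by (simp add: sign_diag_def vec_eq_iff forall_3 matrix_vector_mult_def sum_3)
qed

text \<open>Recovers differentiability of the coefficients from the jets. Any admissible \<alpha>
  will do, and one exists because the filter \<open>at_right 0\<close> is nontrivial.\<close>

lemma unif_O_differentiable:
  assumes "unif_O k (\<lambda>\<alpha>. a)" "0 \<le> r" "r < 1"
  obtains D where "(a r has_real_derivative D) (at s)"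
proof -
  from assms(1) obtain C where "\<forall>\<^sub>F \<alpha> in at_right 0. C1_bound (C * \<alpha> ^ k) a"
    by (elim unif_OE)
  then have "\<exists>\<alpha>. C1_bound (C * \<alpha> ^ k) a"
    by (rule eventually_happens'[rotated]) simp
  with assms(2,3) that show ?thesis unfolding C1_bound_def by blast
qed

theorem proposition3:
  shows "\<exists>\<alpha>\<^sub>0 > (0::real). \<exists>C::real. \<forall>\<epsilon>\<in>{1, -1::real}. \<forall>\<alpha> r s :: real.
    0 < \<alpha> \<and> \<alpha> < \<alpha>\<^sub>0 \<and> 0 \<le> r \<and> r < 1 \<longrightarrow>
      norm (chi \<epsilon> \<alpha> r s - (f0 \<epsilon> s r + \<alpha> *\<^sub>R f1 \<epsilon> s r + \<alpha>\<^sup>2 *\<^sub>R f2 \<epsilon> s r)) \<le> C * \<bar>\<alpha> ^ 3\<bar> \<and>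
      (\<lambda>s. chi \<epsilon> \<alpha> r s) differentiable (at s) \<and>
      norm (vector_derivative (\<lambda>s. chi \<epsilon> \<alpha> r s) (at s)
            - (vector_derivative (\<lambda>s. f0 \<epsilon> s r) (at s)
               + \<alpha> *\<^sub>R vector_derivative (\<lambda>s. f1 \<epsilon> s r) (at s)
               + \<alpha>\<^sup>2 *\<^sub>R vector_derivative (\<lambda>s. f2 \<epsilon> s r) (at s))) \<le> C * \<bar>\<alpha> ^ 3\<bar>"
proof -
  obtain x1 x2 x3 where chi: "\<forall>\<^sub>F \<alpha> in at_right 0. \<forall>\<epsilon>\<in>{1, - 1}. \<forall>r s.
       chi \<epsilon> \<alpha> r s = vector [\<epsilon> * x1 \<alpha> r s, \<epsilon> * x2 \<alpha> r s, x3 \<alpha> r s]"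
    and j: "jet x1 (\<lambda>r s. f0_plus s r $ 1) (\<lambda>r s. f1_plus s r $ 1) (\<lambda>r s. f2_plus s r $ 1)"
    "jet x2 (\<lambda>r s. f0_plus s r $ 2) (\<lambda>r s. f1_plus s r $ 2) (\<lambda>r s. f2_plus s r $ 2)"
    "jet x3 (\<lambda>r s. f0_plus s r $ 3) (\<lambda>r s. f1_plus s r $ 3) (\<lambda>r s. f2_plus s r $ 3)"
    using chi_expansion by blast
  define F where "F i \<alpha> r s = f0_plus s r $ i + \<alpha> * f1_plus s r $ i + \<alpha>\<^sup>2 * f2_plus s r $ i"
    for i :: 3 and \<alpha> r s
  from j have "unif_O 3 (\<lambda>\<alpha> r s. x1 \<alpha> r s - F 1 \<alpha> r s)" "unif_O 3 (\<lambda>\<alpha> r s. x2 \<alpha> r s - F 2 \<alpha> r s)"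
    "unif_O 3 (\<lambda>\<alpha> r s. x3 \<alpha> r s - F 3 \<alpha> r s)"
    unfolding jet_def F_def by blast+
  then obtain C1 C2 C3 where C:
    "\<forall>\<^sub>F \<alpha> in at_right 0. C1_bound (C1 * \<alpha> ^ 3) (\<lambda>r s. x1 \<alpha> r s - F 1 \<alpha> r s)"
    "\<forall>\<^sub>F \<alpha> in at_right 0. C1_bound (C2 * \<alpha> ^ 3) (\<lambda>r s. x2 \<alpha> r s - F 2 \<alpha> r s)"
    "\<forall>\<^sub>F \<alpha> in at_right 0. C1_bound (C3 * \<alpha> ^ 3) (\<lambda>r s. x3 \<alpha> r s - F 3 \<alpha> r s)"
    by (elim unif_OE)
  define good where "good \<alpha> \<longleftrightarrow>
    (\<forall>\<epsilon>\<in>{1, - 1}. \<forall>r s. chi \<epsilon> \<alpha> r s = vector [\<epsilon> * x1 \<alpha> r s, \<epsilon> * x2 \<alpha> r s, x3 \<alpha> r s]) \<and>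
    C1_bound (C1 * \<alpha> ^ 3) (\<lambda>r s. x1 \<alpha> r s - F 1 \<alpha> r s) \<and>
    C1_bound (C2 * \<alpha> ^ 3) (\<lambda>r s. x2 \<alpha> r s - F 2 \<alpha> r s) \<and>
    C1_bound (C3 * \<alpha> ^ 3) (\<lambda>r s. x3 \<alpha> r s - F 3 \<alpha> r s)" for \<alpha>
  have "\<forall>\<^sub>F \<alpha> in at_right 0. good \<alpha>"
    unfolding good_def by (intro eventually_conj chi C)
  then obtain \<alpha>0 where \<alpha>0: "\<alpha>0 > 0" and good: "\<And>\<alpha>. 0 < \<alpha> \<Longrightarrow> \<alpha> < \<alpha>0 \<Longrightarrow> good \<alpha>"
    unfolding eventually_at_right_field by auto
  show ?thesis
  \<comment> \<open>The norm is at most the sum of the absolute values of the components, so the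
    three constants add up; the factor \<epsilon> has absolute value 1.\<close>
  proof (rule exI[of _ \<alpha>0], intro conjI \<alpha>0 exI[of _ "C1 + C2 + C3"] ballI allI impI)
    fix \<epsilon> \<alpha> r s :: real
    assume \<epsilon>: "\<epsilon> \<in> {1, - 1}" and "0 < \<alpha> \<and> \<alpha> < \<alpha>0 \<and> 0 \<le> r \<and> r < 1"
    then have \<alpha>: "0 < \<alpha>" "\<alpha> < \<alpha>0" and r: "0 \<le> r" "r < 1" by auto
    have abs_\<epsilon>: "\<bar>\<epsilon>\<bar> = 1" using \<epsilon> by auto
    have chi_eq: "chi \<epsilon> \<alpha> r s = vector [\<epsilon> * x1 \<alpha> r s, \<epsilon> * x2 \<alpha> r s, x3 \<alpha> r s]" for s
      using good[OF \<alpha>] \<epsilon> unfolding good_def by blast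
    have E1: "C1_bound (C1 * \<alpha> ^ 3) (\<lambda>r s. x1 \<alpha> r s - F 1 \<alpha> r s)"
      and E2: "C1_bound (C2 * \<alpha> ^ 3) (\<lambda>r s. x2 \<alpha> r s - F 2 \<alpha> r s)"
      and E3: "C1_bound (C3 * \<alpha> ^ 3) (\<lambda>r s. x3 \<alpha> r s - F 3 \<alpha> r s)"
      using good[OF \<alpha>] unfolding good_def by simp_all
    let ?\<Phi> = "\<lambda>s. f0 \<epsilon> s r + \<alpha> *\<^sub>R f1 \<epsilon> s r + \<alpha>\<^sup>2 *\<^sub>R f2 \<epsilon> s r"
    have diff_eq: "chi \<epsilon> \<alpha> r s - ?\<Phi> s = vector [\<epsilon> * (x1 \<alpha> r s - F 1 \<alpha> r s),
        \<epsilon> * (x2 \<alpha> r s - F 2 \<alpha> r s), x3 \<alpha> r s - F 3 \<alpha> r s]" for s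
      unfolding chi_eq f0_def f1_def f2_def sign_diag_vector[OF \<epsilon>]
      by (simp add: vec_eq_iff forall_3 F_def algebra_simps)
    obtain D1 where D1: "((\<lambda>s. x1 \<alpha> r s - F 1 \<alpha> r s) has_real_derivative D1) (at s)"
      "\<bar>x1 \<alpha> r s - F 1 \<alpha> r s\<bar> \<le> C1 * \<alpha> ^ 3" "\<bar>D1\<bar> \<le> C1 * \<alpha> ^ 3"
      using E1 r unfolding C1_bound_def by blast
    obtain D2 where D2: "((\<lambda>s. x2 \<alpha> r s - F 2 \<alpha> r s) has_real_derivative D2) (at s)"
      "\<bar>x2 \<alpha> r s - F 2 \<alpha> r s\<bar> \<le> C2 * \<alpha> ^ 3" "\<bar>D2\<bar> \<le> C2 * \<alpha> ^ 3"
      using E2 r unfolding C1_bound_def by blast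
    obtain D3 where D3: "((\<lambda>s. x3 \<alpha> r s - F 3 \<alpha> r s) has_real_derivative D3) (at s)"
      "\<bar>x3 \<alpha> r s - F 3 \<alpha> r s\<bar> \<le> C3 * \<alpha> ^ 3" "\<bar>D3\<bar> \<le> C3 * \<alpha> ^ 3"
      using E3 r unfolding C1_bound_def by blast
    have bound: "norm (vector [\<epsilon> * a, \<epsilon> * b, c] :: real^3) \<le> (C1 + C2 + C3) * \<bar>\<alpha> ^ 3\<bar>"
      if "\<bar>a\<bar> \<le> C1 * \<alpha> ^ 3" "\<bar>b\<bar> \<le> C2 * \<alpha> ^ 3" "\<bar>c\<bar> \<le> C3 * \<alpha> ^ 3" for a b c
      using norm_vector_3[of "\<epsilon> * a" "\<epsilon> * b" c] that \<alpha>(1) abs_\<epsilon> by (simp add: abs_mult distrib_right)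
    show "norm (chi \<epsilon> \<alpha> r s - ?\<Phi> s) \<le> (C1 + C2 + C3) * \<bar>\<alpha> ^ 3\<bar>"
      unfolding diff_eq by (intro bound D1 D2 D3)
    \<comment> \<open>\<open>vector_derivative\<close> is informative only where a derivative
      exists, so existence is established for the coefficient functions first.\<close>
    have d: "(f has_vector_derivative vector_derivative f (at s)) (at s)"
      if f: "f = (\<lambda>s. sign_diag \<epsilon> *v f' s r)" and u: "unif_O 0 (\<lambda>\<alpha> r s. f' s r $ 1)"
        "unif_O 0 (\<lambda>\<alpha> r s. f' s r $ 2)" "unif_O 0 (\<lambda>\<alpha> r s. f' s r $ 3)" for f and f' :: "real \<Rightarrow> real \<Rightarrow> real^3"
    proof -
      obtain d1 where d1: "((\<lambda>s. f' s r $ 1) has_real_derivative d1) (at s)"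
        by (rule unif_O_differentiable[OF u(1) r])
      obtain d2 where d2: "((\<lambda>s. f' s r $ 2) has_real_derivative d2) (at s)"
        by (rule unif_O_differentiable[OF u(2) r])
      obtain d3 where d3: "((\<lambda>s. f' s r $ 3) has_real_derivative d3) (at s)"
        by (rule unif_O_differentiable[OF u(3) r])
      have "(f has_vector_derivative vector [\<epsilon> * d1, \<epsilon> * d2, d3]) (at s)"
        unfolding f sign_diag_vector[OF \<epsilon>] by (intro has_vector_derivative_vector_3 DERIV_cmult d1 d2 d3)
      from vector_derivative_at[OF this] this show ?thesis by simp
    qed
    have d0: "((\<lambda>s. f0 \<epsilon> s r) has_vector_derivative vector_derivative (\<lambda>s. f0 \<epsilon> s r) (at s)) (at s)"
      using j by (intro d[of _ f0_plus]) (simp_all add: f0_def jet_def)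
    have d1: "((\<lambda>s. f1 \<epsilon> s r) has_vector_derivative vector_derivative (\<lambda>s. f1 \<epsilon> s r) (at s)) (at s)"
      using j by (intro d[of _ f1_plus]) (simp_all add: f1_def jet_def)
    have d2: "((\<lambda>s. f2 \<epsilon> s r) has_vector_derivative vector_derivative (\<lambda>s. f2 \<epsilon> s r) (at s)) (at s)"
      using j by (intro d[of _ f2_plus]) (simp_all add: f2_def jet_def)
    let ?D = "vector [\<epsilon> * D1, \<epsilon> * D2, D3] :: real^3"
    let ?\<Phi>' = "vector_derivative (\<lambda>s. f0 \<epsilon> s r) (at s)
      + \<alpha> *\<^sub>R vector_derivative (\<lambda>s. f1 \<epsilon> s r) (at s) + \<alpha>\<^sup>2 *\<^sub>R vector_derivative (\<lambda>s. f2 \<epsilon> s r) (at s)"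
    have \<Phi>: "(?\<Phi> has_vector_derivative ?\<Phi>') (at s)"
      by (intro has_vector_derivative_add
          bounded_linear.has_vector_derivative[OF bounded_linear_scaleR_right] d0 d1 d2)
    \<comment> \<open>The derivative of the error is known and bounded. Adding back the polynomial
      shows that \<open>chi\<close> is differentiable and identifies its derivative without
      computing it explicitly.\<close>
    have "((\<lambda>s. chi \<epsilon> \<alpha> r s - ?\<Phi> s) has_vector_derivative ?D) (at s)"
      unfolding diff_eq by (intro has_vector_derivative_vector_3 DERIV_cmult D1 D2 D3)
    from has_vector_derivative_add[OF this \<Phi>]
    have chi': "((\<lambda>s. chi \<epsilon> \<alpha> r s) has_vector_derivative ?D + ?\<Phi>') (at s)" by simp
    then show "(\<lambda>s. chi \<epsilon> \<alpha> r s) differentiable (at s)" by (rule differentiableI_vector)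
    have "vector_derivative (\<lambda>s. chi \<epsilon> \<alpha> r s) (at s) - ?\<Phi>' = ?D"
      using vector_derivative_at[OF chi'] by simp
    moreover have "norm ?D \<le> (C1 + C2 + C3) * \<bar>\<alpha> ^ 3\<bar>" by (intro bound D1 D2 D3)
    ultimately show "norm (vector_derivative (\<lambda>s. chi \<epsilon> \<alpha> r s) (at s) - ?\<Phi>') \<le> (C1 + C2 + C3) * \<bar>\<alpha> ^ 3\<bar>"
      by simp
  qed
qed

end
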